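(* For a positive integer $n$, let $g(n)$ denote the largest cardinality of a spherical two-distance set in $\mathbb{R}^n$. If $n$ is an integer with $6<n<22$ or $23<n<40$, then $$g(n)=\frac{n(n+1)}{2}.$$ For $n=23$ we have $g(23)=276$ or $g(23)=277$.
   Context: A spherical two-distance set in $\mathbb{R}^n$ is a set $S$ of unit vectors in $\mathbb{R}^n$ (i.e. a subset of the unit sphere $\mathbb{S}^{n-1}$) for which there are two real numbers $a,b$ with $-1\le a,b<1$ such that the inner product of any two distinct vectors of $S$ is either $a$ or $b$. *)

theory Defs
  imports "HOL-Analysis.Analysis"
begin

definition spherical_two_distance_set :: "(real ^ 'n) set \<Rightarrow> bool" where
  "spherical_two_distance_set S \<longleftrightarrow>
     S \<subseteq> sphere 0 1 \<and>
     (\<exists>a b :: real. -1 \<le> a \<and> a < 1 \<and> -1 \<le> b \<and> b < 1 \<and>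
        (\<forall>x\<in>S. \<forall>y\<in>S. x \<noteq> y \<longrightarrow> x \<bullet> y = a \<or> x \<bullet> y = b))"

(* The dimension n is CARD('n). Only finite sets are counted, because card is 0 on infinite
   sets; no information is lost, since subsets of spherical two-distance sets are again
   spherical two-distance sets, so an infinite one would make the set under Max unbounded. *)
definition max_two_distance :: "'n::finite itself \<Rightarrow> nat" where
  "max_two_distance _ =
     Max {card S | S :: (real ^ 'n) set. finite S \<and> spherical_two_distance_set S}"

end

theory Submission
  imports Defs
begin

text \<open>
  The midpoints of the edges of a regular simplex give the lower bound $n(n+1)/2$.

  For the upper bound let $a > b$ be the two inner products. If $a + b \ge 0$, the symmetric
  matrices $xx^T + abI$, $x \in S$, are linearly independent. If $a + b < 0$ and $S$ is larger than
  $n(n+1)/2$, then $-k$ with $k = (1-b)/(a-b)$ is an eigenvalue of an integer matrix of size $|S|$ with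
  multiplicity more than $|S|/2$, so $k$ is an integer (Larman, Rogers and Seidel). The vectors lift to
  equiangular lines with angle $\arccos(1/(2k-1))$ in dimension $n+1$, and the relative bound for these
  leaves only $k = 2$, and $k = 3$ when $n \ge 22$. Then $b = (ka-1)/(k-1)$ and only the parameter $a$
  is free; Delsarte's linear programming bound with Gegenbauer polynomials of degree at most 4 settles
  these two one-parameter families.
\<close>

section \<open>Large eigenspaces of integer matrices\<close>

text \<open>The split on the sign of a + b is forced by one identity: a linear dependency with
  coefficients c satisfies (1-a)(1-b) * sum of c_x^2 = -(a+b) * |sum of c_x x|^2, which gives c = 0
  if a + b >= 0 and nothing otherwise. For a + b < 0, integrality of k leaves one-parameter
  families, but each family is still a continuum of Delsarte problems. The certificates therefore
  let the polynomial vary linearly with a over a whole interval, so that all the required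
  inequalities follow from finitely many rational ones. The exceptions in the range come from k = 3.
  From dimension 22 on the relative bound lets it through, and there the 275 points of the
  McLaughlin graph (products 1/6 and -1/4, so k = 3) exceed 253. In dimension 23 the bound 277
  obtained for k = 3 misses 276 by one. At the upper end, the bound for k = 2 in dimension 39 is 780
  = 39 * 40 / 2, exactly the target.\<close>

lemma rational_eigenvalue_is_int:
  fixes M :: "'a \<Rightarrow> 'a \<Rightarrow> int" and v :: "'a \<Rightarrow> int"
  assumes j: "j \<in> S" "v j \<noteq> 0"
    and par: "\<And>i. i \<in> S \<Longrightarrow> (\<Sum>l\<in>S. M i l * v l) * v j = (\<Sum>l\<in>S. M j l * v l) * v i"
  obtains c where "\<And>i. i \<in> S \<Longrightarrow> (\<Sum>l\<in>S. M i l * v l) = c * v i"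
proof -
  obtain p q where pq: "(\<Sum>l\<in>S. M j l * v l) = p * gcd (\<Sum>l\<in>S. M j l * v l) (v j)"
      "v j = q * gcd (\<Sum>l\<in>S. M j l * v l) (v j)" "coprime p q"
    using gcd_coprime_exists[of "\<Sum>l\<in>S. M j l * v l" "v j"] j by auto
  have eig: "(\<Sum>l\<in>S. M i l * v l) * q = p * v i" if "i \<in> S" for i
  proof -
    have "gcd (\<Sum>l\<in>S. M j l * v l) (v j) \<noteq> 0" using j by simp
    moreover have "(\<Sum>l\<in>S. M i l * v l) * q * gcd (\<Sum>l\<in>S. M j l * v l) (v j)
        = p * v i * gcd (\<Sum>l\<in>S. M j l * v l) (v j)"
      using par[OF that] pq by (metis mult.assoc mult.commute)
    ultimately show ?thesis by (metis mult_right_cancel)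
  qed
  \<comment> \<open>Descent in place of the characteristic polynomial: the eigenvalue is p / q in
    lowest terms, and applying M to w = v / q^k turns the eigenvalue equation into q | p * w_i, so
    every w_i yields another factor q. As v_j is nonzero, this can go on for all k only if q is 1 or
    -1.\<close>
  have pow: "\<exists>w. \<forall>i\<in>S. v i = q ^ k * w i" for k
  proof (induction k)
    case (Suc k)
    then obtain w where w: "\<And>i. i \<in> S \<Longrightarrow> v i = q ^ k * w i" by blast
    have "q ^ k \<noteq> 0" using w[OF j(1)] j(2) by auto
    have "q dvd w i" if "i \<in> S" for i
    proof -
      have "q ^ k * ((\<Sum>l\<in>S. M i l * w l) * q) = (\<Sum>l\<in>S. M i l * v l) * q"
        by (simp add: w sum_distrib_left sum_distrib_right mult_ac)
      also have "\<dots> = q ^ k * (p * w i)" using eig[OF that] w[OF that] by (simp add: mult_ac)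
      finally have "q dvd p * w i" using \<open>q ^ k \<noteq> 0\<close> by (metis dvd_triv_right mult_cancel_left)
      thus ?thesis using pq(3) by (simp add: coprime_commute coprime_dvd_mult_right_iff)
    qed
    then have "\<forall>i\<in>S. v i = q ^ Suc k * (w i div q)" using w by (auto simp: mult.assoc)
    then show ?case by (intro exI[of _ "\<lambda>i. w i div q"])
  qed auto
  have "\<bar>q\<bar> = 1"
  proof (rule ccontr)
    assume "\<bar>q\<bar> \<noteq> 1"
    moreover have "q \<noteq> 0" using pq(2) j(2) by auto
    ultimately have "\<bar>q\<bar> \<ge> 2" by linarith
    define k where "k = nat \<bar>v j\<bar>"
    obtain w where w: "v j = q ^ k * w" using pow[of k] j(1) by blast
    have "int k < 2 ^ k" by (simp add: of_nat_less_two_power)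
    also have "\<dots> \<le> \<bar>q\<bar> ^ k" using \<open>\<bar>q\<bar> \<ge> 2\<close> by (intro power_mono) auto
    also have "\<dots> \<le> \<bar>v j\<bar>" using w j(2)
      by (metis dvd_imp_le_int dvd_triv_left power_abs)
    finally show False by (simp add: k_def)
  qed
  hence "q * q = 1" by (metis abs_mult_self_eq mult_1)
  have "(\<Sum>l\<in>S. M i l * v l) = (p * q) * v i" if "i \<in> S" for i
  proof -
    have "(\<Sum>l\<in>S. M i l * v l) = (\<Sum>l\<in>S. M i l * v l) * (q * q)" using \<open>q * q = 1\<close> by simp
    also have "\<dots> = p * v i * q" using eig[OF that] by (metis mult.assoc)
    finally show ?thesis by (simp add: mult_ac)
  qed
  thus thesis by (rule that)
qed

text \<open>Dirichlet's pigeonhole argument: there are about $T^{|S|}$ integer vectors of height $T$ but only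
  $O(T^{2|C|})$ cells of side $1/(LT)$, so two vectors share a cell.\<close>

lemma small_integer_combination:
  fixes Y :: "'c \<Rightarrow> 'a \<Rightarrow> real" and L :: nat
  assumes fin: "finite S" "finite C" and card: "2 * card C < card S" and L: "L > 0"
  obtains v :: "'a \<Rightarrow> int" and T :: nat and j
  where "T > 0" "j \<in> S" "v j \<noteq> 0" "\<And>i. i \<in> S \<Longrightarrow> \<bar>v i\<bar> \<le> int T"
    "\<And>c. c \<in> C \<Longrightarrow> \<bar>\<Sum>i\<in>S. Y c i * v i\<bar> \<le> 1 / (real L * real T)"
proof -
  define K where "K = nat \<lceil>\<Sum>c\<in>C. \<Sum>i\<in>S. \<bar>Y c i\<bar>\<rceil>"
  have K: "(\<Sum>i\<in>S. \<bar>Y c i\<bar>) \<le> real K" if "c \<in> C" for c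
  proof -
    have "(\<Sum>i\<in>S. \<bar>Y c i\<bar>) \<le> (\<Sum>c\<in>C. \<Sum>i\<in>S. \<bar>Y c i\<bar>)"
      using that fin by (intro member_le_sum) (auto intro: sum_nonneg)
    thus ?thesis unfolding K_def by linarith
  qed
  \<comment> \<open>Choosing T as a power of R absorbs the constant in the number of cells: there
    are at most (R * T^2)^|C| = T^(2|C|+1) of them, fewer than the (T+1)^|S| integer vectors with
    entries in 0..T.\<close>
  define R where "R = 2 * K * L + 1"
  define T where "T = R ^ card C"
  have T: "T > 0" by (simp add: T_def R_def)
  define Z where "Z = K * L * T ^ 2"
  define A where "A = PiE S (\<lambda>_. {0..int T})"
  define f where "f = (\<lambda>v :: 'a \<Rightarrow> int. \<lambda>c\<in>C. \<lfloor>real L * real T * (\<Sum>i\<in>S. Y c i * v i)\<rfloor>)"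
  have "f ` A \<subseteq> PiE C (\<lambda>_. {- int Z..int Z})"
  proof (intro image_subsetI PiE_I)
    fix v c assume v: "v \<in> A" and c: "c \<in> C"
    have "\<bar>\<Sum>i\<in>S. Y c i * v i\<bar> \<le> (\<Sum>i\<in>S. \<bar>Y c i\<bar> * real T)"
    proof (rule order_trans[OF sum_abs], rule sum_mono)
      fix i assume "i \<in> S"
      hence "v i \<in> {0..int T}" using v by (auto simp: A_def)
      hence "\<bar>real_of_int (v i)\<bar> \<le> real T" by auto
      thus "\<bar>Y c i * v i\<bar> \<le> \<bar>Y c i\<bar> * real T" by (simp add: abs_mult mult_left_mono)
    qed
    also have "\<dots> = (\<Sum>i\<in>S. \<bar>Y c i\<bar>) * real T" by (simp add: sum_distrib_right)
    also have "\<dots> \<le> real K * real T" using K[OF c] by (simp add: mult_right_mono)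
    finally have "\<bar>real L * real T * (\<Sum>i\<in>S. Y c i * v i)\<bar> \<le> real L * real T * (real K * real T)"
      by (simp add: abs_mult mult_left_mono)
    also have "\<dots> = real_of_int (int Z)" by (simp add: Z_def power2_eq_square)
    finally show "f v c \<in> {- int Z..int Z}"
      using c unfolding f_def by (simp add: abs_le_iff) linarith
  qed (simp add: f_def)
  moreover have finP: "finite (PiE C (\<lambda>_. {- int Z..int Z}))" using fin by (intro finite_PiE) auto
  ultimately have "card (f ` A) \<le> card (PiE C (\<lambda>_. {- int Z..int Z}))" by (rule card_mono[rotated])
  also have "\<dots> = (2 * Z + 1) ^ card C"
    using fin by (simp add: card_PiE nat_add_distrib nat_mult_distrib)
  also have "\<dots> \<le> (R * T ^ 2) ^ card C"
    using T by (intro power_mono) (auto simp: Z_def R_def algebra_simps)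
  also have "\<dots> = T ^ (2 * card C + 1)"
    by (simp add: power_mult_distrib T_def power_mult[symmetric] power_add[symmetric])
       (simp add: algebra_simps)
  also have "\<dots> < (T + 1) ^ (2 * card C + 1)" by (rule power_strict_mono) auto
  also have "\<dots> \<le> (T + 1) ^ card S" using card by (intro power_increasing) auto
  also have "\<dots> = card A" using fin by (simp add: A_def card_PiE nat_add_distrib)
  finally have "\<not> inj_on f A" by (rule pigeonhole)
  then obtain v1 v2 where v: "v1 \<in> A" "v2 \<in> A" "v1 \<noteq> v2" "f v1 = f v2" by (auto simp: inj_on_def)
  have "\<exists>j\<in>S. v1 j \<noteq> v2 j" using v(1-3) unfolding A_def by (metis PiE_ext)
  then obtain j where j: "j \<in> S" "v1 j - v2 j \<noteq> 0" by auto
  show thesis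
  proof (rule that[OF T j(1), of "\<lambda>i. v1 i - v2 i"])
    show "v1 j - v2 j \<noteq> 0" by (rule j)
    show "\<bar>v1 i - v2 i\<bar> \<le> int T" if "i \<in> S" for i
    proof -
      have "v1 i \<in> {0..int T}" "v2 i \<in> {0..int T}" using v that by (auto simp: A_def)
      thus ?thesis by auto
    qed
    show "\<bar>\<Sum>i\<in>S. Y c i * (v1 i - v2 i)\<bar> \<le> 1 / (real L * real T)" if "c \<in> C" for c
    proof -
      have LT: "real L * real T > 0" using L T by simp
      have "\<lfloor>real L * real T * (\<Sum>i\<in>S. Y c i * v1 i)\<rfloor> = \<lfloor>real L * real T * (\<Sum>i\<in>S. Y c i * v2 i)\<rfloor>"
        using fun_cong[OF v(4), of c] that by (simp add: f_def)
      hence "\<bar>real L * real T * (\<Sum>i\<in>S. Y c i * v1 i) - real L * real T * (\<Sum>i\<in>S. Y c i * v2 i)\<bar> \<le> 1"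
        by linarith
      also have "real L * real T * (\<Sum>i\<in>S. Y c i * v1 i) - real L * real T * (\<Sum>i\<in>S. Y c i * v2 i)
          = real L * real T * (\<Sum>i\<in>S. Y c i * (v1 i - v2 i))"
        by (simp add: algebra_simps sum_subtractf)
      finally show ?thesis using LT by (simp add: abs_mult field_simps)
    qed
  qed
qed

text \<open>The hypothesis says that $M - \theta I$ has rank at most $|C| < |S|/2$. An integer vector $v$
  with $Yv$ tiny satisfies $Mv \approx \theta v$ so closely that the integers
  $(Mv)_i v_j - (Mv)_j v_i$ vanish. Hence $v$ is a rational eigenvector, and its eigenvalue is an
  integer close to $\theta$.\<close>

lemma eigenvalue_of_large_multiplicity_is_int:
  fixes M :: "'a \<Rightarrow> 'a \<Rightarrow> int" and B :: "'a \<Rightarrow> 'c \<Rightarrow> real" and Y :: "'c \<Rightarrow> 'a \<Rightarrow> real"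
  assumes fin: "finite S" "finite C" and card: "2 * card C < card S"
    and fact: "\<And>i j. i \<in> S \<Longrightarrow> j \<in> S \<Longrightarrow>
      real_of_int (M i j) - (if i = j then \<theta> else 0) = (\<Sum>c\<in>C. B i c * Y c j)"
  shows "\<theta> \<in> \<int>"
proof -
  define D where "D = (\<Sum>i\<in>S. \<Sum>c\<in>C. \<bar>B i c\<bar>)"
  have D: "(\<Sum>c\<in>C. \<bar>B i c\<bar>) \<le> D" if "i \<in> S" for i
    unfolding D_def using that fin by (intro member_le_sum) (auto intro: sum_nonneg)
  have D0: "D \<ge> 0" unfolding D_def by (intro sum_nonneg) auto
  have approx: "\<exists>z\<in>\<int>. dist z \<theta> < e" if e: "e > 0" for e
  proof -
    \<comment> \<open>L > 2D pushes the integers (Mv)_i v_j - (Mv)_j v_i below 1 in absolute value;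
      L > D/e brings the resulting integer eigenvalue within e of \<theta>.\<close>
    obtain L :: nat where "real L > max (2 * D) (D / e)" using reals_Archimedean2 by blast
    hence L: "real L > 2 * D" "real L > D / e" by auto
    hence L0: "L > 0" using D0 by (cases L) auto
    obtain v :: "'a \<Rightarrow> int" and T :: nat and j where
      v: "T > 0" "j \<in> S" "v j \<noteq> 0" "\<And>i. i \<in> S \<Longrightarrow> \<bar>v i\<bar> \<le> int T"
      "\<And>c. c \<in> C \<Longrightarrow> \<bar>\<Sum>i\<in>S. Y c i * v i\<bar> \<le> 1 / (real L * real T)"
      using small_integer_combination[OF fin card L0] by metis
    define w where "w i = (\<Sum>l\<in>S. M i l * v l)" for i
    have small: "\<bar>w i - \<theta> * v i\<bar> \<le> D / (real L * real T)" if i: "i \<in> S" for i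
    proof -
      have "w i - \<theta> * v i = (\<Sum>l\<in>S. (real_of_int (M i l) - (if i = l then \<theta> else 0)) * v l)"
        using i fin by (simp add: w_def left_diff_distrib sum_subtractf if_distrib[of "\<lambda>x. x * _"] cong: if_cong)
      also have "\<dots> = (\<Sum>l\<in>S. \<Sum>c\<in>C. B i c * Y c l * v l)"
        using fact i by (simp add: sum_distrib_right)
      also have "\<dots> = (\<Sum>c\<in>C. B i c * (\<Sum>l\<in>S. Y c l * v l))"
        by (subst sum.swap) (simp add: sum_distrib_left mult.assoc)
      finally have "\<bar>w i - \<theta> * v i\<bar> \<le> (\<Sum>c\<in>C. \<bar>B i c * (\<Sum>l\<in>S. Y c l * v l)\<bar>)" by simp
      also have "\<dots> \<le> (\<Sum>c\<in>C. \<bar>B i c\<bar> * (1 / (real L * real T)))"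
        unfolding abs_mult using v(5) by (intro sum_mono mult_left_mono) auto
      also have "\<dots> = (\<Sum>c\<in>C. \<bar>B i c\<bar>) * (1 / (real L * real T))" by (rule sum_distrib_right[symmetric])
      also have "\<dots> \<le> D * (1 / (real L * real T))" using D[OF i] by (intro mult_right_mono) auto
      finally show ?thesis by simp
    qed
    have "w i * v j = w j * v i" if i: "i \<in> S" for i
    proof -
      have bd: "\<bar>(w i - \<theta> * v i) * v j\<bar> \<le> D / real L" if "i \<in> S" "j \<in> S" for i j
      proof -
        have "\<bar>real_of_int (v j)\<bar> \<le> real T" using v(4)[OF that(2)] by linarith
        hence "\<bar>(w i - \<theta> * v i) * v j\<bar> \<le> D / (real L * real T) * real T"
          unfolding abs_mult using small[OF that(1)] D0 by (intro mult_mono) auto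
        thus ?thesis using v(1) by simp
      qed
      have "real_of_int (w i * v j - w j * v i) = (w i - \<theta> * v i) * v j - (w j - \<theta> * v j) * v i"
        by (simp add: algebra_simps)
      hence "\<bar>real_of_int (w i * v j - w j * v i)\<bar> \<le> 2 * (D / real L)"
        using bd[OF i v(2)] bd[OF v(2) i] by linarith
      also have "\<dots> < 1" using L L0 by (simp add: field_simps)
      finally have "\<bar>w i * v j - w j * v i\<bar> < 1" by linarith
      thus ?thesis by simp
    qed
    then obtain c where c: "\<And>i. i \<in> S \<Longrightarrow> w i = c * v i"
      using rational_eigenvalue_is_int[of j S v M] v(2,3) unfolding w_def by metis
    have "\<bar>real_of_int c - \<theta>\<bar> * 1 \<le> \<bar>real_of_int c - \<theta>\<bar> * \<bar>real_of_int (v j)\<bar>"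
      using v(3) by (intro mult_left_mono) auto
    also have "\<dots> = \<bar>w j - \<theta> * v j\<bar>" using c[OF v(2)] by (simp add: abs_mult[symmetric] left_diff_distrib)
    also have "\<dots> \<le> D / (real L * real T)" by (rule small[OF v(2)])
    also have "\<dots> \<le> D / real L" using v(1) D0 L0
      by (intro divide_left_mono) (auto simp: mult_le_cancel_left1)
    also have "\<dots> < e" using L(2) L0 e by (simp add: field_simps)
    finally have "dist (real_of_int c) \<theta> < e" by (simp add: dist_real_def)
    thus ?thesis by auto
  qed
  have "\<theta> \<in> closure \<int>" unfolding closure_approachable using approx by blast
  thus ?thesis using closure_closed[OF closed_Ints] by blast
qed

section \<open>Positivity of Gegenbauer polynomials of degree at most four\<close>

lemma sum_of_bool_mult:
  fixes f :: "'i \<Rightarrow> real"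
  assumes "finite I" "i \<in> I"
  shows "(\<Sum>j\<in>I. of_bool (i = j) * f j) = f i" "(\<Sum>j\<in>I. of_bool (j = i) * f j) = f i"
  using assms by (simp_all add: of_bool_def if_distrib[of "\<lambda>x. x * _"] cong: if_cong)

text \<open>A name for the nested sum lets linearity and exchange of indices act as equations
  between functions of the indices, without rewriting under several binders.\<close>

definition sum3 :: "'i set \<Rightarrow> ('i \<Rightarrow> 'i \<Rightarrow> 'i \<Rightarrow> real) \<Rightarrow> real" where
  "sum3 I F = (\<Sum>i\<in>I. \<Sum>j\<in>I. \<Sum>k\<in>I. F i j k)"

definition sum4 :: "'i set \<Rightarrow> ('i \<Rightarrow> 'i \<Rightarrow> 'i \<Rightarrow> 'i \<Rightarrow> real) \<Rightarrow> real" where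
  "sum4 I F = (\<Sum>i\<in>I. \<Sum>j\<in>I. \<Sum>k\<in>I. \<Sum>l\<in>I. F i j k l)"

lemma sum3_linear:
  "sum3 I (\<lambda>i j k. F i j k + G i j k) = sum3 I F + sum3 I G"
  "sum3 I (\<lambda>i j k. F i j k - G i j k) = sum3 I F - sum3 I G"
  "sum3 I (\<lambda>i j k. c * F i j k) = c * sum3 I F"
  by (simp_all add: sum3_def sum.distrib sum_subtractf sum_distrib_left)

lemma sum4_linear:
  "sum4 I (\<lambda>i j k l. F i j k l + G i j k l) = sum4 I F + sum4 I G"
  "sum4 I (\<lambda>i j k l. F i j k l - G i j k l) = sum4 I F - sum4 I G"
  "sum4 I (\<lambda>i j k l. c * F i j k l) = c * sum4 I F"
  by (simp_all add: sum4_def sum.distrib sum_subtractf sum_distrib_left)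

lemma sum3_swap:
  "sum3 I (\<lambda>i j k. F j i k) = sum3 I F"
  "sum3 I (\<lambda>i j k. F i k j) = sum3 I F"
  unfolding sum3_def
  subgoal by (rule sum.swap)
  subgoal by (rule sum.cong[OF refl]) (rule sum.swap)
  done

lemma sum4_swap:
  "sum4 I (\<lambda>i j k l. F j i k l) = sum4 I F"
  "sum4 I (\<lambda>i j k l. F i k j l) = sum4 I F"
  "sum4 I (\<lambda>i j k l. F i j l k) = sum4 I F"
  unfolding sum4_def
  subgoal by (rule sum.swap)
  subgoal by (rule sum.cong[OF refl]) (rule sum.swap)
  subgoal by (rule sum.cong[OF refl], rule sum.cong[OF refl]) (rule sum.swap)
  done

lemma sum3_power:
  "sum3 I (\<lambda>i j k. (x i * x j * x k) * (y i * y j * y k)) = (\<Sum>i\<in>I. x i * y i) ^ 3"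
  by (simp add: sum3_def power3_eq_cube sum_product mult_ac)
     (simp add: sum_distrib_left mult_ac)

lemma sum4_power:
  "sum4 I (\<lambda>i j k l. (x i * x j * x k * x l) * (y i * y j * y k * y l)) = (\<Sum>i\<in>I. x i * y i) ^ 4"
proof -
  have "(\<Sum>i\<in>I. x i * y i) ^ 4 = (\<Sum>i\<in>I. x i * y i) * ((\<Sum>i\<in>I. x i * y i) * ((\<Sum>i\<in>I. x i * y i) * (\<Sum>i\<in>I. x i * y i)))"
    by (simp add: power4_eq_xxxx mult.assoc)
  thus ?thesis by (simp add: sum4_def sum_distrib_left sum_distrib_right mult_ac)
qed

text \<open>The symmetric traceless parts of $x^{\otimes 3}$ and $x^{\otimes 4}$ for a unit vector $x$,
  provided $\alpha, \beta$ are chosen as in the two trace lemmas.\<close>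

definition harmonic3 :: "real \<Rightarrow> ('i \<Rightarrow> real) \<Rightarrow> 'i \<Rightarrow> 'i \<Rightarrow> 'i \<Rightarrow> real" where
  "harmonic3 \<alpha> x i j k = x i * x j * x k
    - \<alpha> * (of_bool (i = j) * x k + of_bool (i = k) * x j + of_bool (j = k) * x i)"

definition harmonic4 :: "real \<Rightarrow> real \<Rightarrow> ('i \<Rightarrow> real) \<Rightarrow> 'i \<Rightarrow> 'i \<Rightarrow> 'i \<Rightarrow> 'i \<Rightarrow> real" where
  "harmonic4 \<alpha> \<beta> x i j k l = x i * x j * x k * x l
    - \<alpha> * (of_bool (i = j) * (x k * x l) + of_bool (i = k) * (x j * x l) + of_bool (i = l) * (x j * x k)
       + of_bool (j = k) * (x i * x l) + of_bool (j = l) * (x i * x k) + of_bool (k = l) * (x i * x j))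
    + \<beta> * (of_bool (i = j) * of_bool (k = l) + of_bool (i = k) * of_bool (j = l)
       + of_bool (i = l) * of_bool (j = k))"

lemma harmonic3_trace:
  assumes "finite I" "k \<in> I" "(\<Sum>i\<in>I. x i * x i) = 1" and \<alpha>: "\<alpha> * (real (card I) + 2) = 1"
  shows "(\<Sum>i\<in>I. harmonic3 \<alpha> x i i k) = 0"
proof -
  have "harmonic3 \<alpha> x i i k = x k * (x i * x i) - \<alpha> * x k - 2 * \<alpha> * (of_bool (i = k) * x i)" for i
    by (simp add: harmonic3_def algebra_simps)
  hence "(\<Sum>i\<in>I. harmonic3 \<alpha> x i i k) = x k * (1 - \<alpha> * (real (card I) + 2))"
    using assms(1-3)
    by (simp only: sum_subtractf sum_distrib_left[symmetric] sum_of_bool_mult sum_constant)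
       (simp add: algebra_simps)
  thus ?thesis using \<alpha> by simp
qed

lemma harmonic4_trace:
  assumes "finite I" "k \<in> I" "l \<in> I" "(\<Sum>i\<in>I. x i * x i) = 1"
    and \<alpha>: "\<alpha> * (real (card I) + 4) = 1" and \<beta>: "\<beta> * (real (card I) + 2) = \<alpha>"
  shows "(\<Sum>i\<in>I. harmonic4 \<alpha> \<beta> x i i k l) = 0"
proof -
  have "harmonic4 \<alpha> \<beta> x i i k l = (x k * x l) * (x i * x i) - \<alpha> * (x k * x l)
     - (2 * \<alpha> * x l) * (of_bool (i = k) * x i) - (2 * \<alpha> * x k) * (of_bool (i = l) * x i)
     - (\<alpha> * of_bool (k = l)) * (x i * x i) + \<beta> * of_bool (k = l)
     + (2 * \<beta>) * (of_bool (i = k) * of_bool (i = l))" for i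
    by (simp add: harmonic4_def algebra_simps)
  hence "(\<Sum>i\<in>I. harmonic4 \<alpha> \<beta> x i i k l) =
      (x k * x l) * (1 - \<alpha> * (real (card I) + 4)) + of_bool (k = l) * (\<beta> * (real (card I) + 2) - \<alpha>)"
    using assms(1-4)
    by (simp only: sum.distrib sum_subtractf sum_distrib_left[symmetric] sum_of_bool_mult sum_constant)
       (simp add: algebra_simps)
  thus ?thesis using \<alpha> \<beta> by simp
qed

text \<open>Pairing a symmetric tensor with a Kronecker delta takes its trace, whichever two slots
  the delta occupies: the second and third placements come from the first by exchanging neighbouring
  indices.\<close>

lemma sum3_contract:
  assumes fin: "finite I"
    and sym: "\<And>i j k. R j i k = R i j k" "\<And>i j k. R i k j = R i j k"
  shows "sum3 I (\<lambda>i j k. R i j k * (of_bool (i = j) * g k)) = (\<Sum>k\<in>I. g k * (\<Sum>i\<in>I. R i i k))" (is ?t1)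
    and "sum3 I (\<lambda>i j k. R i j k * (of_bool (i = k) * g j)) = (\<Sum>k\<in>I. g k * (\<Sum>i\<in>I. R i i k))" (is ?t2)
    and "sum3 I (\<lambda>i j k. R i j k * (of_bool (j = k) * g i)) = (\<Sum>k\<in>I. g k * (\<Sum>i\<in>I. R i i k))" (is ?t3)
proof -
  have "sum3 I (\<lambda>i j k. R i j k * (of_bool (i = j) * g k)) =
      (\<Sum>i\<in>I. \<Sum>j\<in>I. of_bool (i = j) * (\<Sum>k\<in>I. R i j k * g k))"
    by (simp add: sum3_def sum_distrib_left mult_ac)
  also have "\<dots> = (\<Sum>i\<in>I. \<Sum>k\<in>I. R i i k * g k)"
    using fin by (intro sum.cong refl sum_of_bool_mult)
  also have "\<dots> = (\<Sum>k\<in>I. g k * (\<Sum>i\<in>I. R i i k))"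
    by (subst sum.swap) (simp add: sum_distrib_left mult_ac)
  finally show t1: ?t1 .
  show t2: ?t2
    using sum3_swap(2)[of I "\<lambda>i j k. R i j k * (of_bool (i = j) * g k)"] t1 by (simp add: sym(2))
  show ?t3
    using sum3_swap(1)[of I "\<lambda>i j k. R i j k * (of_bool (i = k) * g j)"] t2 by (simp add: sym(1))
qed

lemma sum4_contract:
  assumes fin: "finite I"
    and sym: "\<And>i j k l. R j i k l = R i j k l" "\<And>i j k l. R i k j l = R i j k l"
      "\<And>i j k l. R i j l k = R i j k l"
  defines "t \<equiv> \<lambda>g. (\<Sum>k\<in>I. \<Sum>l\<in>I. g k l * (\<Sum>i\<in>I. R i i k l))"
  shows "sum4 I (\<lambda>i j k l. R i j k l * (of_bool (i = j) * g k l)) = t g" (is ?t12)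
    and "sum4 I (\<lambda>i j k l. R i j k l * (of_bool (i = k) * g j l)) = t g" (is ?t13)
    and "sum4 I (\<lambda>i j k l. R i j k l * (of_bool (i = l) * g j k)) = t g" (is ?t14)
    and "sum4 I (\<lambda>i j k l. R i j k l * (of_bool (j = k) * g i l)) = t g" (is ?t23)
    and "sum4 I (\<lambda>i j k l. R i j k l * (of_bool (j = l) * g i k)) = t g" (is ?t24)
    and "sum4 I (\<lambda>i j k l. R i j k l * (of_bool (k = l) * g i j)) = t g" (is ?t34)
proof -
  have "sum4 I (\<lambda>i j k l. R i j k l * (of_bool (i = j) * g k l)) =
      (\<Sum>i\<in>I. \<Sum>j\<in>I. of_bool (i = j) * (\<Sum>k\<in>I. \<Sum>l\<in>I. R i j k l * g k l))"
    by (simp add: sum4_def sum_distrib_left mult_ac)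
  also have "\<dots> = (\<Sum>i\<in>I. \<Sum>k\<in>I. \<Sum>l\<in>I. R i i k l * g k l)"
    using fin by (intro sum.cong refl sum_of_bool_mult)
  also have "\<dots> = (\<Sum>k\<in>I. \<Sum>i\<in>I. \<Sum>l\<in>I. R i i k l * g k l)" by (rule sum.swap)
  also have "\<dots> = (\<Sum>k\<in>I. \<Sum>l\<in>I. \<Sum>i\<in>I. R i i k l * g k l)"
    by (rule sum.cong[OF refl]) (rule sum.swap)
  also have "\<dots> = t g" by (simp add: t_def sum_distrib_left mult_ac)
  finally show t12: ?t12 .
  show t13: ?t13
    using sum4_swap(2)[of I "\<lambda>i j k l. R i j k l * (of_bool (i = j) * g k l)"] t12 by (simp add: sym(2))
  show t14: ?t14
    using sum4_swap(3)[of I "\<lambda>i j k l. R i j k l * (of_bool (i = k) * g j l)"] t13 by (simp add: sym(3))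
  show t23: ?t23
    using sum4_swap(1)[of I "\<lambda>i j k l. R i j k l * (of_bool (i = k) * g j l)"] t13 by (simp add: sym(1))
  show t24: ?t24
    using sum4_swap(1)[of I "\<lambda>i j k l. R i j k l * (of_bool (i = l) * g j k)"] t14 by (simp add: sym(1))
  show ?t34
    using sum4_swap(2)[of I "\<lambda>i j k l. R i j k l * (of_bool (j = l) * g i k)"] t24 by (simp add: sym(2))
qed

text \<open>Meant for two kinds of R: if R is traceless, only the leading monomial of
  \<open>harmonic3\<close> survives; if R is the cube of a unit vector y, its trace is y
  again.\<close>

lemma sum3_mult_harmonic3:
  assumes "finite I" "\<And>i j k. R j i k = R i j k" "\<And>i j k. R i k j = R i j k"
  shows "sum3 I (\<lambda>i j k. R i j k * harmonic3 \<alpha> z i j k) =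
    sum3 I (\<lambda>i j k. R i j k * (z i * z j * z k)) - 3 * \<alpha> * (\<Sum>k\<in>I. z k * (\<Sum>i\<in>I. R i i k))"
proof -
  have "(\<lambda>i j k. R i j k * harmonic3 \<alpha> z i j k) = (\<lambda>i j k. R i j k * (z i * z j * z k)
    - \<alpha> * (R i j k * (of_bool (i = j) * z k) + R i j k * (of_bool (i = k) * z j)
         + R i j k * (of_bool (j = k) * z i)))"
    by (simp add: harmonic3_def fun_eq_iff algebra_simps)
  thus ?thesis by (simp only: sum3_linear sum3_contract[of I R, OF assms]) (simp add: algebra_simps)
qed

lemma sum4_mult_harmonic4:
  assumes "finite I" "\<And>i j k l. R j i k l = R i j k l" "\<And>i j k l. R i k j l = R i j k l"
    "\<And>i j k l. R i j l k = R i j k l"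
  shows "sum4 I (\<lambda>i j k l. R i j k l * harmonic4 \<alpha> \<beta> z i j k l) =
    sum4 I (\<lambda>i j k l. R i j k l * (z i * z j * z k * z l))
    - 6 * \<alpha> * (\<Sum>k\<in>I. \<Sum>l\<in>I. (z k * z l) * (\<Sum>i\<in>I. R i i k l))
    + 3 * \<beta> * (\<Sum>k\<in>I. \<Sum>l\<in>I. of_bool (k = l) * (\<Sum>i\<in>I. R i i k l))"
proof -
  have "(\<lambda>i j k l. R i j k l * harmonic4 \<alpha> \<beta> z i j k l) = (\<lambda>i j k l. R i j k l * (z i * z j * z k * z l)
    - \<alpha> * (R i j k l * (of_bool (i = j) * (z k * z l)) + R i j k l * (of_bool (i = k) * (z j * z l))
         + R i j k l * (of_bool (i = l) * (z j * z k)) + R i j k l * (of_bool (j = k) * (z i * z l))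
         + R i j k l * (of_bool (j = l) * (z i * z k)) + R i j k l * (of_bool (k = l) * (z i * z j)))
    + \<beta> * (R i j k l * (of_bool (i = j) * of_bool (k = l)) + R i j k l * (of_bool (i = k) * of_bool (j = l))
         + R i j k l * (of_bool (i = l) * of_bool (j = k))))"
    by (simp add: harmonic4_def fun_eq_iff algebra_simps)
  thus ?thesis
    by (simp only: sum4_linear sum4_contract(1-6)[of I R "\<lambda>k l. z k * z l", OF assms]
        sum4_contract(1-3)[of I R "\<lambda>k l. of_bool (k = l)", OF assms]) (simp add: algebra_simps)
qed

text \<open>The right-hand side is the monic Gegenbauer polynomial of degree 3 at the inner product
  of x and y. One factor is traceless, so the other may be replaced by its leading monomial; only
  one correction term remains.\<close>

lemma sum3_harmonic3_harmonic3:
  assumes "finite I" and x: "(\<Sum>i\<in>I. x i * x i) = 1" and y: "(\<Sum>i\<in>I. y i * y i) = 1"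
    and \<alpha>: "\<alpha> * (real (card I) + 2) = 1"
  shows "sum3 I (\<lambda>i j k. harmonic3 \<alpha> x i j k * harmonic3 \<alpha> y i j k) =
    (\<Sum>i\<in>I. x i * y i) ^ 3 - 3 * \<alpha> * (\<Sum>i\<in>I. x i * y i)"
proof -
  have "sum3 I (\<lambda>i j k. harmonic3 \<alpha> x i j k * harmonic3 \<alpha> y i j k) =
      sum3 I (\<lambda>i j k. harmonic3 \<alpha> x i j k * (y i * y j * y k))
      - 3 * \<alpha> * (\<Sum>k\<in>I. y k * (\<Sum>i\<in>I. harmonic3 \<alpha> x i i k))"
    by (rule sum3_mult_harmonic3[OF assms(1)]) (auto simp: harmonic3_def algebra_simps eq_commute)
  also have "\<dots> = sum3 I (\<lambda>i j k. (y i * y j * y k) * harmonic3 \<alpha> x i j k)"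
    using assms by (simp add: harmonic3_trace mult_ac)
  also have "\<dots> = sum3 I (\<lambda>i j k. (y i * y j * y k) * (x i * x j * x k))
      - 3 * \<alpha> * (\<Sum>k\<in>I. x k * (\<Sum>i\<in>I. y i * y i * y k))"
    by (rule sum3_mult_harmonic3[OF assms(1)]) auto
  also have "\<dots> = (\<Sum>i\<in>I. x i * y i) ^ 3 - 3 * \<alpha> * (\<Sum>i\<in>I. x i * y i)"
    using y by (simp only: sum3_power sum_distrib_right[symmetric]) (simp add: mult_ac)
  finally show ?thesis .
qed

lemma sum4_harmonic4_harmonic4:
  assumes "finite I" and x: "(\<Sum>i\<in>I. x i * x i) = 1" and y: "(\<Sum>i\<in>I. y i * y i) = 1"
    and \<alpha>: "\<alpha> * (real (card I) + 4) = 1" and \<beta>: "\<beta> * (real (card I) + 2) = \<alpha>"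
  shows "sum4 I (\<lambda>i j k l. harmonic4 \<alpha> \<beta> x i j k l * harmonic4 \<alpha> \<beta> y i j k l) =
    (\<Sum>i\<in>I. x i * y i) ^ 4 - 6 * \<alpha> * (\<Sum>i\<in>I. x i * y i) ^ 2 + 3 * \<beta>"
proof -
  have "sum4 I (\<lambda>i j k l. harmonic4 \<alpha> \<beta> x i j k l * harmonic4 \<alpha> \<beta> y i j k l) =
      sum4 I (\<lambda>i j k l. harmonic4 \<alpha> \<beta> x i j k l * (y i * y j * y k * y l))
      - 6 * \<alpha> * (\<Sum>k\<in>I. \<Sum>l\<in>I. (y k * y l) * (\<Sum>i\<in>I. harmonic4 \<alpha> \<beta> x i i k l))
      + 3 * \<beta> * (\<Sum>k\<in>I. \<Sum>l\<in>I. of_bool (k = l) * (\<Sum>i\<in>I. harmonic4 \<alpha> \<beta> x i i k l))"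
    by (rule sum4_mult_harmonic4[OF assms(1)]) (auto simp: harmonic4_def algebra_simps eq_commute)
  also have "\<dots> = sum4 I (\<lambda>i j k l. (y i * y j * y k * y l) * harmonic4 \<alpha> \<beta> x i j k l)"
    using assms by (simp add: harmonic4_trace mult_ac)
  also have "\<dots> = sum4 I (\<lambda>i j k l. (y i * y j * y k * y l) * (x i * x j * x k * x l))
      - 6 * \<alpha> * (\<Sum>k\<in>I. \<Sum>l\<in>I. (x k * x l) * (\<Sum>i\<in>I. y i * y i * y k * y l))
      + 3 * \<beta> * (\<Sum>k\<in>I. \<Sum>l\<in>I. of_bool (k = l) * (\<Sum>i\<in>I. y i * y i * y k * y l))"
    by (rule sum4_mult_harmonic4[OF assms(1)]) auto
  also have "(\<lambda>k l. \<Sum>i\<in>I. y i * y i * y k * y l) = (\<lambda>k l. y k * y l)"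
    using y by (simp only: sum_distrib_right[symmetric]) simp
  also have "(\<Sum>k\<in>I. \<Sum>l\<in>I. (x k * x l) * (y k * y l)) = (\<Sum>i\<in>I. x i * y i) ^ 2"
    by (simp add: power2_eq_square sum_product mult_ac)
  also have "(\<Sum>k\<in>I. \<Sum>l\<in>I. of_bool (k = l) * (y k * y l)) = 1"
    using sum_of_bool_mult(1)[OF assms(1)] y by simp
  finally show ?thesis by (simp only: sum4_power) (simp add: mult.commute)
qed

section \<open>Positive semidefinite kernels on the sphere\<close>

lemma sum_sum_mult_nonneg:
  fixes f :: "'a \<Rightarrow> real"
  shows "0 \<le> (\<Sum>x\<in>S. \<Sum>y\<in>S. f x * f y)"
  by (simp add: sum_product[symmetric])

lemma sum_sum_sum3_nonneg:
  "0 \<le> (\<Sum>x\<in>S. \<Sum>y\<in>S. sum3 I (\<lambda>i j k. H x i j k * H y i j k))"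
proof -
  have "(\<Sum>x\<in>S. sum3 I (G x)) = sum3 I (\<lambda>i j k. \<Sum>x\<in>S. G x i j k)" for G :: "'a \<Rightarrow> 'b \<Rightarrow> 'b \<Rightarrow> 'b \<Rightarrow> real"
    by (induction S rule: infinite_finite_induct) (simp_all add: sum3_linear, simp_all add: sum3_def)
  hence "(\<Sum>x\<in>S. \<Sum>y\<in>S. sum3 I (\<lambda>i j k. H x i j k * H y i j k)) =
      sum3 I (\<lambda>i j k. \<Sum>x\<in>S. \<Sum>y\<in>S. H x i j k * H y i j k)" by simp
  also have "\<dots> \<ge> 0" unfolding sum3_def by (intro sum_nonneg sum_sum_mult_nonneg)
  finally show ?thesis .
qed

lemma sum_sum_sum4_nonneg:
  "0 \<le> (\<Sum>x\<in>S. \<Sum>y\<in>S. sum4 I (\<lambda>i j k l. H x i j k l * H y i j k l))"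
proof -
  have "(\<Sum>x\<in>S. sum4 I (G x)) = sum4 I (\<lambda>i j k l. \<Sum>x\<in>S. G x i j k l)"
    for G :: "'a \<Rightarrow> 'b \<Rightarrow> 'b \<Rightarrow> 'b \<Rightarrow> 'b \<Rightarrow> real"
    by (induction S rule: infinite_finite_induct) (simp_all add: sum4_linear, simp_all add: sum4_def)
  hence "(\<Sum>x\<in>S. \<Sum>y\<in>S. sum4 I (\<lambda>i j k l. H x i j k l * H y i j k l)) =
      sum4 I (\<lambda>i j k l. \<Sum>x\<in>S. \<Sum>y\<in>S. H x i j k l * H y i j k l)" by simp
  also have "\<dots> \<ge> 0" unfolding sum4_def by (intro sum_nonneg sum_sum_mult_nonneg)
  finally show ?thesis .
qed

text \<open>An isometric embedding into m-dimensional space, written in coordinates indexed by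
  numbers so that m can be a term and not a type.\<close>

lemma zero_padding:
  assumes "CARD('n::finite) \<le> m"
  obtains u :: "real ^ 'n \<Rightarrow> nat \<Rightarrow> real" where "\<And>x y. (\<Sum>i<m. u x i * u y i) = x \<bullet> y"
proof -
  obtain \<phi> where \<phi>: "bij_betw \<phi> {..<CARD('n)} (UNIV :: 'n set)"
    using ex_bij_betw_nat_finite[of "UNIV :: 'n set"] by (auto simp: atLeast0LessThan)
  define u :: "real ^ 'n \<Rightarrow> nat \<Rightarrow> real" where "u x i = (if i < CARD('n) then x $ \<phi> i else 0)" for x i
  have "(\<Sum>i<m. u x i * u y i) = x \<bullet> y" for x y
  proof -
    have "(\<Sum>i<m. u x i * u y i) = (\<Sum>i<CARD('n). u x i * u y i)"
      using assms by (intro sum.mono_neutral_right) (auto simp: u_def)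
    also have "\<dots> = (\<Sum>i<CARD('n). x $ \<phi> i * y $ \<phi> i)" by (simp add: u_def)
    also have "\<dots> = x \<bullet> y"
      by (simp add: inner_vec_def sum.reindex_bij_betw[OF \<phi>, of "\<lambda>i. x $ i * y $ i"])
    finally show ?thesis .
  qed
  thus thesis by (rule that)
qed

text \<open>Stated for any $m$ at least the dimension, so that one numerical certificate for dimension $m$
  serves several dimensions.\<close>

lemma gegenbauer_positivity:
  fixes S :: "(real ^ 'n) set"
  assumes S: "S \<subseteq> sphere 0 1" and m: "CARD('n) \<le> m"
  shows "0 \<le> (\<Sum>x\<in>S. \<Sum>y\<in>S. x \<bullet> y)" (is ?t1)
    and "0 \<le> (\<Sum>x\<in>S. \<Sum>y\<in>S. (x \<bullet> y)\<^sup>2 - 1 / m)" (is ?t2)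
    and "0 \<le> (\<Sum>x\<in>S. \<Sum>y\<in>S. (x \<bullet> y) ^ 3 - 3 / (real m + 2) * (x \<bullet> y))" (is ?t3)
    and "0 \<le> (\<Sum>x\<in>S. \<Sum>y\<in>S. (x \<bullet> y) ^ 4 - 6 / (real m + 4) * (x \<bullet> y)\<^sup>2 + 3 / ((real m + 2) * (real m + 4)))" (is ?t4)
proof -
  show ?t1 by (simp add: inner_sum_left[symmetric] inner_sum_right[symmetric])
  have m0: "m > 0" using m by (metis zero_less_card_finite order.strict_trans2)
  obtain u :: "real ^ 'n \<Rightarrow> nat \<Rightarrow> real" where u: "\<And>x y. (\<Sum>i<m. u x i * u y i) = x \<bullet> y"
    using zero_padding[OF m] by blast
  have unit: "(\<Sum>i<m. u x i * u x i) = 1" if "x \<in> S" for x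
    using that S by (auto simp: u dot_square_norm)
  \<comment> \<open>The kernel of degree 2 is the Gram matrix of the traceless matrices x x^T - I/m,
    so its sum over all pairs is a sum of squares.\<close>
  have "(\<Sum>i<m. \<Sum>j<m. (u x i * u x j - of_bool (i = j) / m) * (u y i * u y j - of_bool (i = j) / m))
      = (x \<bullet> y)\<^sup>2 - 1 / m" if "x \<in> S" "y \<in> S" for x y
  proof -
    have e: "(u x i * u x j - of_bool (i = j) / m) * (u y i * u y j - of_bool (i = j) / m)
      = (u x i * u y i) * (u x j * u y j) - of_bool (i = j) * (u x j * u x j / m)
        - of_bool (i = j) * (u y j * u y j / m) + of_bool (i = j) * (1 / m ^ 2)" for i j
      by (cases "i = j") (simp_all add: algebra_simps diff_divide_distrib power2_eq_square)
    have "(\<Sum>i<m. \<Sum>j<m. (u x i * u x j - of_bool (i = j) / m) * (u y i * u y j - of_bool (i = j) / m))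
      = (\<Sum>i<m. u x i * u y i)\<^sup>2 - (\<Sum>i<m. u x i * u x i) / m - (\<Sum>i<m. u y i * u y i) / m
        + (\<Sum>i<m. 1 / m ^ 2)"
    proof -
      have "(\<Sum>i<m. \<Sum>j<m. of_bool (i = j) * f j) = (\<Sum>i<m. f i)" for f :: "nat \<Rightarrow> real"
        by (intro sum.cong refl sum_of_bool_mult) auto
      thus ?thesis
        unfolding e by (simp only: sum.distrib sum_subtractf power2_eq_square sum_product sum_divide_distrib)
    qed
    thus ?thesis using m0 by (simp add: u unit[OF that(1), unfolded u] unit[OF that(2), unfolded u])
        (simp add: field_simps power2_eq_square)
  qed
  hence "(\<Sum>x\<in>S. \<Sum>y\<in>S. (x \<bullet> y)\<^sup>2 - 1 / m) = (\<Sum>x\<in>S. \<Sum>y\<in>S. \<Sum>i<m. \<Sum>j<m.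
      (u x i * u x j - of_bool (i = j) / m) * (u y i * u y j - of_bool (i = j) / m))"
    by (intro sum.cong refl) simp
  also have "\<dots> = (\<Sum>i<m. \<Sum>j<m. \<Sum>x\<in>S. \<Sum>y\<in>S.
      (u x i * u x j - of_bool (i = j) / m) * (u y i * u y j - of_bool (i = j) / m))"
    by (simp only: sum.swap[of _ "{..<m}" S])
  also have "\<dots> \<ge> 0" by (intro sum_nonneg sum_sum_mult_nonneg)
  finally show ?t2 .
  have "(\<Sum>x\<in>S. \<Sum>y\<in>S. (x \<bullet> y) ^ 3 - 3 / (real m + 2) * (x \<bullet> y)) =
      (\<Sum>x\<in>S. \<Sum>y\<in>S. sum3 {..<m} (\<lambda>i j k. harmonic3 (1 / (real m + 2)) (u x) i j k * harmonic3 (1 / (real m + 2)) (u y) i j k))"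
    using unit by (intro sum.cong refl) (simp add: sum3_harmonic3_harmonic3 u)
  also have "\<dots> \<ge> 0" by (rule sum_sum_sum3_nonneg)
  finally show ?t3 by simp
  define \<alpha> \<beta> where "\<alpha> = 1 / (real m + 4)" "\<beta> = 1 / ((real m + 2) * (real m + 4))"
  have \<alpha>\<beta>: "\<alpha> * (real (card {..<m}) + 4) = 1" "\<beta> * (real (card {..<m}) + 2) = \<alpha>"
    by (simp_all add: \<alpha>_\<beta>_def)
  have "(\<Sum>x\<in>S. \<Sum>y\<in>S. (x \<bullet> y) ^ 4 - 6 * \<alpha> * (x \<bullet> y)\<^sup>2 + 3 * \<beta>) =
      (\<Sum>x\<in>S. \<Sum>y\<in>S. sum4 {..<m} (\<lambda>i j k l. harmonic4 \<alpha> \<beta> (u x) i j k l * harmonic4 \<alpha> \<beta> (u y) i j k l))"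
    using unit by (intro sum.cong refl) (simp only: sum4_harmonic4_harmonic4[OF _ _ _ \<alpha>\<beta>] u finite_lessThan)
  also have "\<dots> \<ge> 0" by (rule sum_sum_sum4_nonneg)
  finally show ?t4 by (simp add: \<alpha>_\<beta>_def)
qed

section \<open>Delsarte certificates\<close>

text \<open>The polar form of the polynomial $\sum_i c_i P_i(t)$, where $P_1,\dots,P_4$ are the monic
  Gegenbauer polynomials of dimension $m$. Its values at arguments from $\{l, u\}$ are the Bernstein
  coefficients of the polynomial on $[l, u]$.\<close>

definition blossom :: "real \<Rightarrow> real \<times> real \<times> real \<times> real \<Rightarrow> real \<Rightarrow> real \<Rightarrow> real \<Rightarrow> real \<Rightarrow> real" where
  "blossom m = (\<lambda>(c1, c2, c3, c4) x y z w.
     c1 * ((x + y + z + w) / 4)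
   + c2 * ((x * y + x * z + x * w + y * z + y * w + z * w) / 6 - 1 / m)
   + c3 * ((x * y * z + x * y * w + x * z * w + y * z * w) / 4 - 3 / (m + 2) * ((x + y + z + w) / 4))
   + c4 * (x * y * z * w - 6 / (m + 4) * ((x * y + x * z + x * w + y * z + y * w + z * w) / 6)
           + 3 / ((m + 2) * (m + 4))))"

abbreviation gegenbauer_comb :: "real \<Rightarrow> real \<times> real \<times> real \<times> real \<Rightarrow> real \<Rightarrow> real" where
  "gegenbauer_comb m c t \<equiv> blossom m c t t t t"

definition nonneg4 :: "real \<times> real \<times> real \<times> real \<Rightarrow> bool" where
  "nonneg4 = (\<lambda>(c1, c2, c3, c4). 0 \<le> c1 \<and> 0 \<le> c2 \<and> 0 \<le> c3 \<and> 0 \<le> c4)"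

lemma gegenbauer_comb_positivity:
  fixes S :: "(real ^ 'n) set"
  assumes "S \<subseteq> sphere 0 1" "CARD('n) \<le> m" "nonneg4 c"
  shows "0 \<le> (\<Sum>x\<in>S. \<Sum>y\<in>S. gegenbauer_comb m c (x \<bullet> y))"
proof -
  obtain c1 c2 c3 c4 where c: "c = (c1, c2, c3, c4)" by (metis surj_pair)
  have "gegenbauer_comb m c t = c1 * t + c2 * (t\<^sup>2 - 1 / m) + c3 * (t ^ 3 - 3 / (real m + 2) * t)
      + c4 * (t ^ 4 - 6 / (real m + 4) * t\<^sup>2 + 3 / ((real m + 2) * (real m + 4)))" for t
  proof -
    have "(t + t + t + t) / 4 = t" "(t * t + t * t + t * t + t * t + t * t + t * t) / 6 = t\<^sup>2"
      "(t * t * t + t * t * t + t * t * t + t * t * t) / 4 = t ^ 3" "t * t * t * t = t ^ 4"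
      by (simp_all add: power2_eq_square power3_eq_cube power4_eq_xxxx)
    thus ?thesis unfolding c blossom_def prod.case by (simp only:)
  qed
  hence "(\<Sum>x\<in>S. \<Sum>y\<in>S. gegenbauer_comb m c (x \<bullet> y)) =
      c1 * (\<Sum>x\<in>S. \<Sum>y\<in>S. x \<bullet> y) + c2 * (\<Sum>x\<in>S. \<Sum>y\<in>S. (x \<bullet> y)\<^sup>2 - 1 / m)
      + c3 * (\<Sum>x\<in>S. \<Sum>y\<in>S. (x \<bullet> y) ^ 3 - 3 / (real m + 2) * (x \<bullet> y))
      + c4 * (\<Sum>x\<in>S. \<Sum>y\<in>S. (x \<bullet> y) ^ 4 - 6 / (real m + 4) * (x \<bullet> y)\<^sup>2 + 3 / ((real m + 2) * (real m + 4)))"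
    by (simp only: sum.distrib sum_distrib_left distrib_left)
  thus ?thesis using gegenbauer_positivity[OF assms(1,2)] assms(3)
    by (simp add: c nonneg4_def)
qed

lemma blossom_affine:
  assumes "r + s = 1"
  shows "blossom m c (r * l + s * u) y z w = r * blossom m c l y z w + s * blossom m c u y z w"
proof -
  obtain c1 c2 c3 c4 where c: "c = (c1, c2, c3, c4)" by (metis surj_pair)
  have r: "r = 1 - s" using assms by simp
  show ?thesis unfolding c blossom_def r prod.case
    by (simp add: algebra_simps add_divide_distrib diff_divide_distrib)
qed

lemma blossom_commute:
  "blossom m c x y z w = blossom m c y x z w"
  "blossom m c x y z w = blossom m c z y x w"
  "blossom m c x y z w = blossom m c w y z x"
  by (simp_all add: blossom_def case_prod_unfold ac_simps)

text \<open>The polar form is affine in each slot, so the diagonal value expands like a fourth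
  power; symmetry collects the sixteen terms into five.\<close>

lemma gegenbauer_comb_bernstein:
  assumes "r + s = 1"
  shows "gegenbauer_comb m c (r * l + s * u) = r ^ 4 * blossom m c l l l l + 4 * (r ^ 3 * s) * blossom m c l l l u
    + 6 * (r\<^sup>2 * s\<^sup>2) * blossom m c l l u u + 4 * (r * s ^ 3) * blossom m c l u u u + s ^ 4 * blossom m c u u u u"
proof -
  have aff: "blossom m c (r * l + s * u) y z w = r * blossom m c l y z w + s * blossom m c u y z w"
    "blossom m c x (r * l + s * u) z w = r * blossom m c x l z w + s * blossom m c x u z w"
    "blossom m c x y (r * l + s * u) w = r * blossom m c x y l w + s * blossom m c x y u w"
    "blossom m c x y z (r * l + s * u) = r * blossom m c x y z l + s * blossom m c x y z u" for x y z w
    using blossom_affine[OF assms] blossom_commute[of m c] by metis+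
  have "blossom m c l l u l = blossom m c l l l u" "blossom m c l u l l = blossom m c l l l u"
    "blossom m c u l l l = blossom m c l l l u" "blossom m c l u l u = blossom m c l l u u"
    "blossom m c l u u l = blossom m c l l u u" "blossom m c u l l u = blossom m c l l u u"
    "blossom m c u l u l = blossom m c l l u u" "blossom m c u u l l = blossom m c l l u u"
    "blossom m c u u u l = blossom m c l u u u" "blossom m c u u l u = blossom m c l u u u"
    "blossom m c u l u u = blossom m c l u u u"
    by (simp_all add: blossom_def case_prod_unfold ac_simps)
  thus ?thesis unfolding aff
    by (simp add: algebra_simps power2_eq_square power3_eq_cube power4_eq_xxxx)
qed

text \<open>The conditions bound the degree-5 Bernstein coefficients of
  $(1 - s) P_c(t) + s P_d(t)$ with $t = (1 - s) l + s u$.\<close>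

definition below_on :: "real \<Rightarrow> real \<Rightarrow> real \<Rightarrow> real \<times> real \<times> real \<times> real \<Rightarrow> real \<times> real \<times> real \<times> real \<Rightarrow> bool" where
  "below_on m l u c d \<longleftrightarrow>
     blossom m c l l l l \<le> -1 \<and>
     4 * blossom m c l l l u + blossom m d l l l l \<le> -5 \<and>
     6 * blossom m c l l u u + 4 * blossom m d l l l u \<le> -10 \<and>
     4 * blossom m c l u u u + 6 * blossom m d l l u u \<le> -10 \<and>
     blossom m c u u u u + 4 * blossom m d l u u u \<le> -5 \<and>
     blossom m d u u u u \<le> -1"

text \<open>The right-hand sides in \<open>below_on\<close> are minus the binomial coefficients of
  degree 5, so the weighted bounds add up to -(r+s)^5 = -1.\<close>

lemma below_onD:
  assumes b: "below_on m l u c d" and rs: "r + s = 1" "0 \<le> r" "0 \<le> s"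
  shows "r * gegenbauer_comb m c (r * l + s * u) + s * gegenbauer_comb m d (r * l + s * u) \<le> -1"
proof -
  have "r * gegenbauer_comb m c (r * l + s * u) + s * gegenbauer_comb m d (r * l + s * u) =
      r ^ 5 * blossom m c l l l l
    + (r ^ 4 * s) * (4 * blossom m c l l l u + blossom m d l l l l)
    + (r ^ 3 * s\<^sup>2) * (6 * blossom m c l l u u + 4 * blossom m d l l l u)
    + (r\<^sup>2 * s ^ 3) * (4 * blossom m c l u u u + 6 * blossom m d l l u u)
    + (r * s ^ 4) * (blossom m c u u u u + 4 * blossom m d l u u u)
    + s ^ 5 * blossom m d u u u u"
    unfolding gegenbauer_comb_bernstein[OF rs(1)] by (simp add: algebra_simps eval_nat_numeral)
  also have "\<dots> \<le> r ^ 5 * (-1) + (r ^ 4 * s) * (-5) + (r ^ 3 * s\<^sup>2) * (-10) + (r\<^sup>2 * s ^ 3) * (-10)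
    + (r * s ^ 4) * (-5) + s ^ 5 * (-1)"
    using b rs unfolding below_on_def by (intro add_mono mult_left_mono) auto
  also have "\<dots> = - ((r + s) ^ 5)" by (simp add: algebra_simps eval_nat_numeral)
  finally show ?thesis using rs by simp
qed

text \<open>A Delsarte certificate for all pairs $a \in [l, u]$, $b = (ka - 1)/(k - 1)$ at once: the
  polynomial used for a given $a$ interpolates linearly between \<open>c\<close> (at $l$) and \<open>d\<close> (at $u$).\<close>

definition lp_certificate ::
  "nat \<Rightarrow> real \<Rightarrow> nat \<Rightarrow> real \<Rightarrow> real \<Rightarrow> real \<times> real \<times> real \<times> real \<Rightarrow> real \<times> real \<times> real \<times> real \<Rightarrow> bool" where
  "lp_certificate m k N l u c d \<longleftrightarrow> l < u \<and> nonneg4 c \<and> nonneg4 d \<and>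
     gegenbauer_comb (real m) c 1 < real N \<and> gegenbauer_comb (real m) d 1 < real N \<and>
     below_on (real m) l u c d \<and>
     below_on (real m) ((k * l - 1) / (k - 1)) ((k * u - 1) / (k - 1)) c d"

text \<open>Delsarte's argument: the sum of g over all pairs is nonnegative, while each row
  contributes at most g(1) - (|S| - 1), hence |S| <= 1 + g(1). The strict g(1) < N is enough for |S|
  <= N because |S| is an integer.\<close>

lemma lp_bound:
  fixes S :: "(real ^ 'n) set" and m N :: nat
  assumes fin: "finite S" and S: "S \<subseteq> sphere 0 1" and m: "CARD('n) \<le> m"
    and ip: "\<And>x y. x \<in> S \<Longrightarrow> y \<in> S \<Longrightarrow> x \<noteq> y \<Longrightarrow> x \<bullet> y = a \<or> x \<bullet> y = (k * a - 1) / (k - 1)"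
    and a: "l \<le> a" "a \<le> u" and cert: "lp_certificate m k N l u c d"
  shows "card S \<le> N"
proof (cases "S = {}")
  case False
  define s where "s = (a - l) / (u - l)"
  define r where "r = 1 - s"
  have "l < u" using cert by (simp add: lp_certificate_def)
  have rs: "r + s = 1" "0 \<le> r" "0 \<le> s"
    using a \<open>l < u\<close> by (auto simp: r_def s_def divide_le_eq_1)
  have "s * (u - l) = a - l" using \<open>l < u\<close> by (simp add: s_def)
  hence a_eq: "a = r * l + s * u" by (simp add: r_def algebra_simps)
  \<comment> \<open>The second product is affine in a, so the weights that locate a in [l, u] also
    locate b between its end values; one pair \<open>c\<close>, \<open>d\<close> thus controls both
    products.\<close>
  have "k * a - 1 = r * (k * l - 1) + s * (k * u - 1)" by (simp add: r_def a_eq algebra_simps)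
  hence b_eq: "(k * a - 1) / (k - 1) = r * ((k * l - 1) / (k - 1)) + s * ((k * u - 1) / (k - 1))"
    by (simp add: add_divide_distrib)
  define g where "g t = r * gegenbauer_comb m c t + s * gegenbauer_comb m d t" for t
  have ga: "g a \<le> -1" "g ((k * a - 1) / (k - 1)) \<le> -1"
    unfolding g_def using cert rs
    by (auto simp only: a_eq[symmetric] b_eq[symmetric] lp_certificate_def dest!: below_onD)
  have "r * gegenbauer_comb m c 1 + s * gegenbauer_comb m d 1 < r * N + s * N"
  \<comment> \<open>Strictness comes from the term of \<open>c\<close> when r > 0, and otherwise
    from the term of \<open>d\<close> with s = 1.\<close>
  proof (cases "r = 0")
    case False
    thus ?thesis using cert rs unfolding lp_certificate_def
      by (intro add_less_le_mono mult_strict_left_mono mult_left_mono) auto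
  next
    case True
    thus ?thesis using cert rs unfolding lp_certificate_def by simp
  qed
  hence g1: "g 1 < N" using rs(1) unfolding g_def by (simp add: distrib_right[symmetric])
  have "0 \<le> (\<Sum>x\<in>S. \<Sum>y\<in>S. g (x \<bullet> y))"
  proof -
    have "(\<Sum>x\<in>S. \<Sum>y\<in>S. g (x \<bullet> y)) = r * (\<Sum>x\<in>S. \<Sum>y\<in>S. gegenbauer_comb m c (x \<bullet> y))
        + s * (\<Sum>x\<in>S. \<Sum>y\<in>S. gegenbauer_comb m d (x \<bullet> y))"
      by (simp add: g_def sum.distrib sum_distrib_left)
    also have "\<dots> \<ge> 0" using cert rs
      by (intro add_nonneg_nonneg mult_nonneg_nonneg gegenbauer_comb_positivity[OF S m])
         (auto simp: lp_certificate_def)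
    finally show ?thesis .
  qed
  also have "(\<Sum>x\<in>S. \<Sum>y\<in>S. g (x \<bullet> y)) \<le> (\<Sum>x\<in>S. g 1 - (real (card S) - 1))"
  proof (rule sum_mono)
    fix x assume x: "x \<in> S"
    have "(\<Sum>y\<in>S. g (x \<bullet> y)) = g (x \<bullet> x) + (\<Sum>y\<in>S - {x}. g (x \<bullet> y))"
      using fin x by (rule sum.remove)
    also have "x \<bullet> x = 1" using x S by (auto simp: dot_square_norm)
    also have "(\<Sum>y\<in>S - {x}. g (x \<bullet> y)) \<le> (\<Sum>y\<in>S - {x}. -1)"
    proof (rule sum_mono)
      fix y assume "y \<in> S - {x}"
      hence "x \<bullet> y = a \<or> x \<bullet> y = (k * a - 1) / (k - 1)" using ip x by auto
      thus "g (x \<bullet> y) \<le> -1" using ga by auto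
    qed
    also have "\<dots> = - (real (card S) - 1)"
      using card.remove[OF fin x] by simp
    finally show "(\<Sum>y\<in>S. g (x \<bullet> y)) \<le> g 1 - (real (card S) - 1)" by simp
  qed
  also have "\<dots> = card S * (g 1 - (real (card S) - 1))" by simp
  finally have "g 1 - (real (card S) - 1) \<ge> 0"
    using fin False by (simp add: zero_le_mult_iff card_gt_0_iff)
  thus ?thesis using g1 by linarith
qed simp

section \<open>Numerical certificates for k = 2\<close>

text \<open>The coefficients were found by solving, in floating point, the linear program in the eight
  entries of \<open>c\<close> and \<open>d\<close> and rounding.\<close>

lemma lp_bound_2_dim_7:
  fixes S :: "(real ^ 'n) set"
  assumes fin: "finite S" and S: "S \<subseteq> sphere 0 1" and m: "CARD('n) \<le> 7"
    and ip: "\<And>x y. x \<in> S \<Longrightarrow> y \<in> S \<Longrightarrow> x \<noteq> y \<Longrightarrow> x \<bullet> y = a \<or> x \<bullet> y = (2 * a - 1) / (2 - 1)"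
    and a: "0 \<le> a" "a \<le> 1 / 3"
  shows "card S \<le> 28"
proof -
  have c1: "lp_certificate 7 2 28 0 (1 / 4)
      (0, 73 / 10, 109 / 10, 0) (47 / 10, 0, 161 / 5, 0)"
    by (simp add: lp_certificate_def nonneg4_def below_on_def blossom_def)
  have c2: "lp_certificate 7 2 28 (1 / 4) (3 / 10)
      (0, 0, 148993 / 10000, 372537 / 10000) (3 / 10000, 0, 14427 / 2000, 47821 / 1000)"
    by (simp add: lp_certificate_def nonneg4_def below_on_def blossom_def)
  have c3: "lp_certificate 7 2 28 (3 / 10) (1 / 3)
      (0, 0, 7, 48) (0, 2, 0, 54)"
    by (simp add: lp_certificate_def nonneg4_def below_on_def blossom_def)
  consider "0 \<le> a" "a \<le> 1 / 4" | "1 / 4 \<le> a" "a \<le> 3 / 10" | "3 / 10 \<le> a" "a \<le> 1 / 3" using a by linarith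
  thus ?thesis
  proof cases
    case 1
    thus ?thesis using lp_bound[OF fin S m ip _ _ c1] by simp
  next
    case 2
    thus ?thesis using lp_bound[OF fin S m ip _ _ c2] by simp
  next
    case 3
    thus ?thesis using lp_bound[OF fin S m ip _ _ c3] by simp
  qed
qed

text \<open>36 = 8 * 9 / 2 is the target for dimension 8, so a certificate for dimension 9 settles
  both 8 and 9. The further blocks are chosen in the same way: the certificate is for the top
  dimension, the bound is p(p+1)/2 for the bottom dimension p.\<close>

lemma lp_bound_2_dim_9:
  fixes S :: "(real ^ 'n) set"
  assumes fin: "finite S" and S: "S \<subseteq> sphere 0 1" and m: "CARD('n) \<le> 9"
    and ip: "\<And>x y. x \<in> S \<Longrightarrow> y \<in> S \<Longrightarrow> x \<noteq> y \<Longrightarrow> x \<bullet> y = a \<or> x \<bullet> y = (2 * a - 1) / (2 - 1)"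
    and a: "0 \<le> a" "a \<le> 1 / 3"
  shows "card S \<le> 36"
proof -
  have c1: "lp_certificate 9 2 36 0 (7 / 25)
      (0, 91 / 10, 383 / 10, 0) (33 / 20, 0, 427 / 20, 671 / 20)"
    by (simp add: lp_certificate_def nonneg4_def below_on_def blossom_def)
  have c2: "lp_certificate 9 2 36 (7 / 25) (1 / 3)
      (0, 0, 11, 45) (0, 1, 0, 58)"
    by (simp add: lp_certificate_def nonneg4_def below_on_def blossom_def)
  consider "0 \<le> a" "a \<le> 7 / 25" | "7 / 25 \<le> a" "a \<le> 1 / 3" using a by linarith
  thus ?thesis
  proof cases
    case 1
    thus ?thesis using lp_bound[OF fin S m ip _ _ c1] by simp
  next
    case 2
    thus ?thesis using lp_bound[OF fin S m ip _ _ c2] by simp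
  qed
qed

lemma lp_bound_2_dim_12:
  fixes S :: "(real ^ 'n) set"
  assumes fin: "finite S" and S: "S \<subseteq> sphere 0 1" and m: "CARD('n) \<le> 12"
    and ip: "\<And>x y. x \<in> S \<Longrightarrow> y \<in> S \<Longrightarrow> x \<noteq> y \<Longrightarrow> x \<bullet> y = a \<or> x \<bullet> y = (2 * a - 1) / (2 - 1)"
    and a: "0 \<le> a" "a \<le> 1 / 3"
  shows "card S \<le> 55"
proof -
  have c1: "lp_certificate 12 2 55 0 (8 / 25)
      (0, 12, 55, 0) (3 / 2, 0, 39 / 2, 119 / 2)"
    by (simp add: lp_certificate_def nonneg4_def below_on_def blossom_def)
  have c2: "lp_certificate 12 2 55 (8 / 25) (1 / 3)
      (0, 0, 4, 61) (0, 0, 0, 63)"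
    by (simp add: lp_certificate_def nonneg4_def below_on_def blossom_def)
  consider "0 \<le> a" "a \<le> 8 / 25" | "8 / 25 \<le> a" "a \<le> 1 / 3" using a by linarith
  thus ?thesis
  proof cases
    case 1
    thus ?thesis using lp_bound[OF fin S m ip _ _ c1] by simp
  next
    case 2
    thus ?thesis using lp_bound[OF fin S m ip _ _ c2] by simp
  qed
qed

lemma lp_bound_2_dim_17:
  fixes S :: "(real ^ 'n) set"
  assumes fin: "finite S" and S: "S \<subseteq> sphere 0 1" and m: "CARD('n) \<le> 17"
    and ip: "\<And>x y. x \<in> S \<Longrightarrow> y \<in> S \<Longrightarrow> x \<noteq> y \<Longrightarrow> x \<bullet> y = a \<or> x \<bullet> y = (2 * a - 1) / (2 - 1)"
    and a: "0 \<le> a" "a \<le> 1 / 3"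
  shows "card S \<le> 91"
proof -
  have c1: "lp_certificate 17 2 91 0 (1 / 3)
      (0, 87 / 5, 81, 0) (6 / 5, 0, 127 / 5, 429 / 5)"
    by (simp add: lp_certificate_def nonneg4_def below_on_def blossom_def)
  show ?thesis by (rule lp_bound[OF fin S m ip a c1])
qed

lemma lp_bound_2_dim_28:
  fixes S :: "(real ^ 'n) set"
  assumes fin: "finite S" and S: "S \<subseteq> sphere 0 1" and m: "CARD('n) \<le> 28"
    and ip: "\<And>x y. x \<in> S \<Longrightarrow> y \<in> S \<Longrightarrow> x \<noteq> y \<Longrightarrow> x \<bullet> y = a \<or> x \<bullet> y = (2 * a - 1) / (2 - 1)"
    and a: "0 \<le> a" "a \<le> 1 / 3"
  shows "card S \<le> 171"
proof -
  have c1: "lp_certificate 28 2 171 0 (3 / 10)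
      (0, 28, 309 / 2, 0) (0, 0, 46, 153)"
    by (simp add: lp_certificate_def nonneg4_def below_on_def blossom_def)
  have c2: "lp_certificate 28 2 171 (3 / 10) (1 / 3)
      (1 / 5, 0, 159 / 5, 861 / 5) (0, 0, 46 / 5, 986 / 5)"
    by (simp add: lp_certificate_def nonneg4_def below_on_def blossom_def)
  consider "0 \<le> a" "a \<le> 3 / 10" | "3 / 10 \<le> a" "a \<le> 1 / 3" using a by linarith
  thus ?thesis
  proof cases
    case 1
    thus ?thesis using lp_bound[OF fin S m ip _ _ c1] by simp
  next
    case 2
    thus ?thesis using lp_bound[OF fin S m ip _ _ c2] by simp
  qed
qed

lemma lp_bound_2_dim_35:
  fixes S :: "(real ^ 'n) set"
  assumes fin: "finite S" and S: "S \<subseteq> sphere 0 1" and m: "CARD('n) \<le> 35"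
    and ip: "\<And>x y. x \<in> S \<Longrightarrow> y \<in> S \<Longrightarrow> x \<noteq> y \<Longrightarrow> x \<bullet> y = a \<or> x \<bullet> y = (2 * a - 1) / (2 - 1)"
    and a: "0 \<le> a" "a \<le> 1 / 3"
  shows "card S \<le> 435"
proof -
  have c1: "lp_certificate 35 2 435 0 (31 / 100)
      (15 / 2, 35, 383, 0) (0, 0, 72, 771 / 2)"
    by (simp add: lp_certificate_def nonneg4_def below_on_def blossom_def)
  have c2: "lp_certificate 35 2 435 (31 / 100) (1 / 3)
      (0, 0, 55, 370) (0, 0, 9, 420)"
    by (simp add: lp_certificate_def nonneg4_def below_on_def blossom_def)
  consider "0 \<le> a" "a \<le> 31 / 100" | "31 / 100 \<le> a" "a \<le> 1 / 3" using a by linarith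
  thus ?thesis
  proof cases
    case 1
    thus ?thesis using lp_bound[OF fin S m ip _ _ c1] by simp
  next
    case 2
    thus ?thesis using lp_bound[OF fin S m ip _ _ c2] by simp
  qed
qed

lemma lp_bound_2_dim_38:
  fixes S :: "(real ^ 'n) set"
  assumes fin: "finite S" and S: "S \<subseteq> sphere 0 1" and m: "CARD('n) \<le> 38"
    and ip: "\<And>x y. x \<in> S \<Longrightarrow> y \<in> S \<Longrightarrow> x \<noteq> y \<Longrightarrow> x \<bullet> y = a \<or> x \<bullet> y = (2 * a - 1) / (2 - 1)"
    and a: "0 \<le> a" "a \<le> 1 / 3"
  shows "card S \<le> 666"
proof -
  have c1: "lp_certificate 38 2 666 0 (31 / 100)
      (17, 38, 634, 0) (0, 0, 107, 631)"
    by (simp add: lp_certificate_def nonneg4_def below_on_def blossom_def)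
  have c2: "lp_certificate 38 2 666 (31 / 100) (1 / 3)
      (0, 0, 89, 602) (0, 0, 12, 686)"
    by (simp add: lp_certificate_def nonneg4_def below_on_def blossom_def)
  consider "0 \<le> a" "a \<le> 31 / 100" | "31 / 100 \<le> a" "a \<le> 1 / 3" using a by linarith
  thus ?thesis
  proof cases
    case 1
    thus ?thesis using lp_bound[OF fin S m ip _ _ c1] by simp
  next
    case 2
    thus ?thesis using lp_bound[OF fin S m ip _ _ c2] by simp
  qed
qed

lemma lp_bound_2_dim_39:
  fixes S :: "(real ^ 'n) set"
  assumes fin: "finite S" and S: "S \<subseteq> sphere 0 1" and m: "CARD('n) \<le> 39"
    and ip: "\<And>x y. x \<in> S \<Longrightarrow> y \<in> S \<Longrightarrow> x \<noteq> y \<Longrightarrow> x \<bullet> y = a \<or> x \<bullet> y = (2 * a - 1) / (2 - 1)"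
    and a: "0 \<le> a" "a \<le> 1 / 3"
  shows "card S \<le> 780"
proof -
  have c1: "lp_certificate 39 2 780 0 (31 / 100)
      (22, 39, 776, 0) (0, 0, 126, 769)"
    by (simp add: lp_certificate_def nonneg4_def below_on_def blossom_def)
  have c2: "lp_certificate 39 2 780 (31 / 100) (1 / 3)
      (0, 0, 110, 742) (0, 0, 13, 846)"
    by (simp add: lp_certificate_def nonneg4_def below_on_def blossom_def)
  consider "0 \<le> a" "a \<le> 31 / 100" | "31 / 100 \<le> a" "a \<le> 1 / 3" using a by linarith
  thus ?thesis
  proof cases
    case 1
    thus ?thesis using lp_bound[OF fin S m ip _ _ c1] by simp
  next
    case 2
    thus ?thesis using lp_bound[OF fin S m ip _ _ c2] by simp
  qed
qed

section \<open>Numerical certificates for k = 3\<close>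

text \<open>The only certificate whose bound is not of the form p(p+1)/2: it exceeds 276 = 23 * 24 /
  2 by one, which is the ambiguity in dimension 23.\<close>

lemma lp_bound_3_dim_23:
  fixes S :: "(real ^ 'n) set"
  assumes fin: "finite S" and S: "S \<subseteq> sphere 0 1" and m: "CARD('n) \<le> 23"
    and ip: "\<And>x y. x \<in> S \<Longrightarrow> y \<in> S \<Longrightarrow> x \<noteq> y \<Longrightarrow> x \<bullet> y = a \<or> x \<bullet> y = (3 * a - 1) / (3 - 1)"
    and a: "-1 / 3 \<le> a" "a \<le> 1 / 5"
  shows "card S \<le> 277"
proof -
  have c1: "lp_certificate 23 3 277 (-1 / 3) (4 / 25)
      (25, 104, 86, 0) (84 / 5, 0, 1226 / 5, 0)"
    by (simp add: lp_certificate_def nonneg4_def below_on_def blossom_def)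
  have c2: "lp_certificate 23 3 277 (4 / 25) (19 / 100)
      (0, 0, 549 / 10, 2923 / 10) (0, 19 / 10, 73 / 5, 3353 / 10)"
    by (simp add: lp_certificate_def nonneg4_def below_on_def blossom_def)
  have c3: "lp_certificate 23 3 277 (19 / 100) (1 / 5)
      (0, 0, 15, 336) (0, 2, 0, 350)"
    by (simp add: lp_certificate_def nonneg4_def below_on_def blossom_def)
  consider "-1 / 3 \<le> a" "a \<le> 4 / 25" | "4 / 25 \<le> a" "a \<le> 19 / 100" | "19 / 100 \<le> a" "a \<le> 1 / 5" using a by linarith
  thus ?thesis
  proof cases
    case 1
    thus ?thesis using lp_bound[OF fin S m ip _ _ c1] by simp
  next
    case 2
    thus ?thesis using lp_bound[OF fin S m ip _ _ c2] by simp
  next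
    case 3
    thus ?thesis using lp_bound[OF fin S m ip _ _ c3] by simp
  qed
qed

lemma lp_bound_3_dim_27:
  fixes S :: "(real ^ 'n) set"
  assumes fin: "finite S" and S: "S \<subseteq> sphere 0 1" and m: "CARD('n) \<le> 27"
    and ip: "\<And>x y. x \<in> S \<Longrightarrow> y \<in> S \<Longrightarrow> x \<noteq> y \<Longrightarrow> x \<bullet> y = a \<or> x \<bullet> y = (3 * a - 1) / (3 - 1)"
    and a: "-1 / 3 \<le> a" "a \<le> 1 / 5"
  shows "card S \<le> 300"
proof -
  have c1: "lp_certificate 27 3 300 (-1 / 3) (4 / 25)
      (144 / 5, 119, 486 / 5, 0) (64 / 5, 0, 1226 / 5, 0)"
    by (simp add: lp_certificate_def nonneg4_def below_on_def blossom_def)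
  have c2: "lp_certificate 27 3 300 (4 / 25) (1 / 5)
      (0, 0, 59, 301) (0, 0, 1, 365)"
    by (simp add: lp_certificate_def nonneg4_def below_on_def blossom_def)
  consider "-1 / 3 \<le> a" "a \<le> 4 / 25" | "4 / 25 \<le> a" "a \<le> 1 / 5" using a by linarith
  thus ?thesis
  proof cases
    case 1
    thus ?thesis using lp_bound[OF fin S m ip _ _ c1] by simp
  next
    case 2
    thus ?thesis using lp_bound[OF fin S m ip _ _ c2] by simp
  qed
qed

lemma lp_bound_3_dim_39:
  fixes S :: "(real ^ 'n) set"
  assumes fin: "finite S" and S: "S \<subseteq> sphere 0 1" and m: "CARD('n) \<le> 39"
    and ip: "\<And>x y. x \<in> S \<Longrightarrow> y \<in> S \<Longrightarrow> x \<noteq> y \<Longrightarrow> x \<bullet> y = a \<or> x \<bullet> y = (3 * a - 1) / (3 - 1)"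
    and a: "-1 / 3 \<le> a" "a \<le> 1 / 5"
  shows "card S \<le> 406"
proof -
  have c1: "lp_certificate 39 3 406 (-1 / 3) (17 / 100)
      (44, 906 / 5, 721 / 5, 0) (10, 41 / 5, 1813 / 5, 0)"
    by (simp add: lp_certificate_def nonneg4_def below_on_def blossom_def)
  have c2: "lp_certificate 39 3 406 (17 / 100) (1 / 5)
      (0, 0, 56, 391) (0, 0, 2, 449)"
    by (simp add: lp_certificate_def nonneg4_def below_on_def blossom_def)
  consider "-1 / 3 \<le> a" "a \<le> 17 / 100" | "17 / 100 \<le> a" "a \<le> 1 / 5" using a by linarith
  thus ?thesis
  proof cases
    case 1
    thus ?thesis using lp_bound[OF fin S m ip _ _ c1] by simp
  next
    case 2
    thus ?thesis using lp_bound[OF fin S m ip _ _ c2] by simp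
  qed
qed

section \<open>The construction and the case of nonnegative sum\<close>

text \<open>The polynomial (t-a)(t-b) separates the points of S, but its linear term would cost n
  more dimensions and give only n(n+3)/2. On unit vectors the constant ab is the quadratic form of
  abI, so the matrices carry everything except -(a+b)t. For a dependency c that term sums to
  -(a+b)|d|^2, whose sign is right when a + b >= 0.\<close>

lemma two_distance_card_le_of_sum_nonneg:
  fixes S :: "(real ^ 'n) set"
  assumes fin: "finite S" and S: "S \<subseteq> sphere 0 1" and ab: "a < 1" "b < 1" "0 \<le> a + b"
    and ip: "\<And>x y. x \<in> S \<Longrightarrow> y \<in> S \<Longrightarrow> x \<noteq> y \<Longrightarrow> x \<bullet> y = a \<or> x \<bullet> y = b"
  shows "card S \<le> CARD('n) * (CARD('n) + 1) div 2"
proof -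
  define M :: "real ^ 'n \<Rightarrow> real ^ 'n ^ 'n" where "M x = (\<chi> i j. x $ i * x $ j + a * b * of_bool (i = j))" for x
  have unit: "x \<bullet> x = 1" if "x \<in> S" for x using that S by (auto simp: dot_square_norm)
  have ker: "c y = 0" if c: "(\<Sum>x\<in>S. c x *\<^sub>R M x) = 0" and y: "y \<in> S" for c :: "real ^ 'n \<Rightarrow> real" and y
  proof -
    have quad: "(\<Sum>x\<in>S. c x * ((x \<bullet> y)\<^sup>2 + a * b)) = 0" if "y \<in> S" for y
    proof -
      have "(x \<bullet> y)\<^sup>2 + a * b = (\<Sum>i\<in>UNIV. \<Sum>j\<in>UNIV. y $ i * y $ j * M x $ i $ j)" for x
      proof -
        have "(\<Sum>i\<in>UNIV. \<Sum>j\<in>UNIV. y $ i * y $ j * M x $ i $ j) =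
          (\<Sum>i\<in>UNIV. \<Sum>j\<in>UNIV. (x $ i * y $ i) * (x $ j * y $ j))
          + (\<Sum>i\<in>UNIV. \<Sum>j\<in>UNIV. of_bool (i = j) * (a * b * (y $ i * y $ j)))"
          by (simp add: M_def algebra_simps sum.distrib)
        also have "\<dots> = (x \<bullet> y)\<^sup>2 + a * b * (y \<bullet> y)"
        proof -
          have "(\<Sum>i\<in>UNIV. \<Sum>j\<in>UNIV. (x $ i * y $ i) * (x $ j * y $ j)) = (x \<bullet> y)\<^sup>2"
            by (simp add: inner_vec_def power2_eq_square sum_product)
          moreover have "(\<Sum>i\<in>UNIV. \<Sum>j\<in>UNIV. of_bool (i = j) * (a * b * (y $ i * y $ j))) = a * b * (y \<bullet> y)"
            by (simp add: inner_vec_def sum_distrib_left if_distrib[of "\<lambda>x. x * _"] of_bool_def cong: if_cong)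
          ultimately show ?thesis by simp
        qed
        finally show ?thesis using unit[OF \<open>y \<in> S\<close>] by simp
      qed
      hence "(\<Sum>x\<in>S. c x * ((x \<bullet> y)\<^sup>2 + a * b)) =
          (\<Sum>x\<in>S. \<Sum>i\<in>UNIV. \<Sum>j\<in>UNIV. y $ i * y $ j * (c x * M x $ i $ j))"
        by (simp add: sum_distrib_left mult_ac)
      also have "\<dots> = (\<Sum>i\<in>UNIV. \<Sum>j\<in>UNIV. \<Sum>x\<in>S. y $ i * y $ j * (c x * M x $ i $ j))"
        by (simp only: sum.swap[of _ UNIV S])
      also have "\<dots> = (\<Sum>i\<in>UNIV. \<Sum>j\<in>UNIV. y $ i * y $ j * (\<Sum>x\<in>S. c x *\<^sub>R M x) $ i $ j)"
        by (simp add: sum_distrib_left)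
      finally show ?thesis by (simp add: c)
    qed
    define d where "d = (\<Sum>x\<in>S. c x *\<^sub>R x)"
    have key: "(1 - a) * (1 - b) * c y = - (a + b) * (d \<bullet> y)" if y: "y \<in> S" for y
    proof -
      have "(\<Sum>x\<in>S. c x * ((x \<bullet> y - a) * (x \<bullet> y - b))) = (\<Sum>x\<in>S. if x = y then c y * ((1 - a) * (1 - b)) else 0)"
        using ip[OF _ y] unit[OF y] by (intro sum.cong refl) auto
      also have "\<dots> = c y * ((1 - a) * (1 - b))" using fin y by simp
      finally have "(1 - a) * (1 - b) * c y = (\<Sum>x\<in>S. c x * ((x \<bullet> y - a) * (x \<bullet> y - b)))" by simp
      also have "\<dots> = (\<Sum>x\<in>S. c x * ((x \<bullet> y)\<^sup>2 + a * b)) - (a + b) * (\<Sum>x\<in>S. c x * (x \<bullet> y))"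
        by (simp add: sum_distrib_left sum_subtractf[symmetric] algebra_simps power2_eq_square)
      also have "\<dots> = - (a + b) * (d \<bullet> y)"
        using quad[OF y] by (simp add: d_def inner_sum_left algebra_simps)
      finally show ?thesis .
    qed
    have "(1 - a) * (1 - b) * (\<Sum>y\<in>S. (c y)\<^sup>2) = (\<Sum>y\<in>S. c y * ((1 - a) * (1 - b) * c y))"
      by (simp add: sum_distrib_left power2_eq_square mult_ac)
    also have "\<dots> = (\<Sum>y\<in>S. c y * (- (a + b) * (d \<bullet> y)))" using key by (intro sum.cong refl) simp
    also have "\<dots> = - (a + b) * (\<Sum>y\<in>S. c y * (d \<bullet> y))" by (simp add: sum_distrib_left mult_ac)
    also have "(\<Sum>y\<in>S. c y * (d \<bullet> y)) = d \<bullet> d"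
      by (subst (3) d_def) (simp add: inner_sum_right)
    also have "- (a + b) * (d \<bullet> d) \<le> 0" using ab(3) by (intro mult_nonpos_nonneg) auto
    finally have "(1 - a) * (1 - b) * (\<Sum>y\<in>S. (c y)\<^sup>2) \<le> 0" .
    moreover have "(1 - a) * (1 - b) > 0" using ab by simp
    ultimately have "(\<Sum>y\<in>S. (c y)\<^sup>2) \<le> 0" by (meson mult_pos_pos not_le)
    hence "(\<Sum>y\<in>S. (c y)\<^sup>2) = 0" by (intro antisym sum_nonneg) auto
    thus ?thesis using fin y by (simp add: sum_nonneg_eq_0_iff)
  qed
  have inj: "inj_on M S"
  proof (rule inj_onI, rule ccontr)
    fix x y assume xy: "x \<in> S" "y \<in> S" "M x = M y" "x \<noteq> y"
    have "(\<Sum>z\<in>S. (of_bool (z = x) - of_bool (z = y)) *\<^sub>R M z) = M x - M y"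
      using fin xy by (simp add: algebra_simps sum_subtractf of_bool_def if_distrib[of "\<lambda>c. c *\<^sub>R _"] cong: if_cong)
    hence "(of_bool (x = x) - of_bool (x = y) :: real) = 0"
      using xy by (intro ker[of "\<lambda>z. of_bool (z = x) - of_bool (z = y)"]) auto
    thus False using xy by simp
  qed
  have indep: "independent (M ` S)"
  proof (rule independent_if_scalars_zero)
    fix f A assume f: "(\<Sum>A\<in>M ` S. f A *\<^sub>R A) = 0" and A: "A \<in> M ` S"
    have "(\<Sum>x\<in>S. f (M x) *\<^sub>R M x) = 0" using f by (simp add: sum.reindex[OF inj])
    thus "f A = 0" using ker[of "\<lambda>x. f (M x)"] A by auto
  qed (use fin in simp)
  \<comment> \<open>A basis of the symmetric matrices indexed by the sets {i, j}: singletons give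
    the diagonal, pairs the symmetric off-diagonal units. This is where n + (n choose 2) comes
    from.\<close>
  define E :: "'n set \<Rightarrow> real ^ 'n ^ 'n" where "E P = (\<chi> i j. of_bool ({i, j} = P))" for P
  define Q :: "'n set set" where "Q = {P. card P = 1} \<union> {P. card P = 2}"
  have "M x \<in> span (E ` Q)" for x
  proof -
    define v where "v P = (if card P = 1 then (\<Prod>i\<in>P. x $ i)\<^sup>2 + a * b else (\<Prod>i\<in>P. x $ i))" for P
    have "M x $ i $ j = (\<Sum>P\<in>Q. v P *\<^sub>R E P) $ i $ j" for i j
    proof -
      have "{i, j} \<in> Q" by (cases "i = j") (auto simp: Q_def)
      hence "(\<Sum>P\<in>Q. v P *\<^sub>R E P) $ i $ j = v {i, j}"
        by (simp add: E_def of_bool_def if_distrib[of "\<lambda>c. _ * c"] cong: if_cong)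
      also have "\<dots> = M x $ i $ j"
        by (cases "i = j") (auto simp: v_def M_def power2_eq_square)
      finally show ?thesis by simp
    qed
    hence "M x = (\<Sum>P\<in>Q. v P *\<^sub>R E P)" by (simp add: vec_eq_iff)
    also have "\<dots> \<in> span (E ` Q)" by (intro span_sum span_scale span_base) auto
    finally show ?thesis .
  qed
  hence "card (M ` S) \<le> card (E ` Q)"
    using independent_span_bound[OF _ indep] by (meson finite finite_imageI image_subsetI)
  also have "\<dots> \<le> card Q" by (rule card_image_le) simp
  also have "\<dots> \<le> card {P :: 'n set. card P = 1} + card {P :: 'n set. card P = 2}"
    unfolding Q_def by (rule card_Un_le)
  also have "\<dots> = CARD('n) + (CARD('n) choose 2)"
    using n_subsets[of "UNIV :: 'n set" 1] n_subsets[of "UNIV :: 'n set" 2] by simp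
  also have "\<dots> = CARD('n) * (CARD('n) + 1) div 2"
    by (cases "CARD('n)") (simp_all add: choose_two)
  finally show ?thesis by (simp add: card_image[OF inj])
qed

section \<open>Lower bound from the edges of a simplex\<close>

text \<open>These are the inner products of the standard basis of (n+1)-space projected off the
  all-ones vector. Inside n-space, the ansatz e_i + \<beta>(1,...,1) for n vertices and
  -\<sigma>(1,...,1) for the vertex \<open>None\<close> leads to \<sigma>^2 = 1/(n+1) and 1 +
  n\<beta> = \<sigma>.\<close>

lemma regular_simplex:
  obtains w :: "'n::finite option \<Rightarrow> real ^ 'n"
  where "\<And>i j. w i \<bullet> w j = of_bool (i = j) - 1 / (real CARD('n) + 1)"
proof -
  define n where "n = real CARD('n)"
  define \<sigma> where "\<sigma> = 1 / sqrt (n + 1)"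
  define \<beta> where "\<beta> = (\<sigma> - 1) / n"
  define w :: "'n option \<Rightarrow> real ^ 'n" where
    "w = case_option (vec (- \<sigma>)) (\<lambda>i. axis i 1 + vec \<beta>)"
  have n: "n > 0" by (simp add: n_def)
  have \<sigma>: "\<sigma> * \<sigma> = 1 / (n + 1)" using n by (simp add: \<sigma>_def)
  have \<beta>: "n * \<beta> = \<sigma> - 1" using n by (simp add: \<beta>_def)
  have v: "vec s \<bullet> (vec t :: real ^ 'n) = n * (s * t)" "(vec s :: real ^ 'n) \<bullet> axis i 1 = s"
    "axis i 1 \<bullet> (vec s :: real ^ 'n) = s" for s t :: real and i
    subgoal by (simp add: inner_vec_def n_def)
    subgoal by (simp add: inner_axis)
    subgoal by (simp add: inner_axis')
    done
  have "2 * \<beta> + n * (\<beta> * \<beta>) = ((1 + n * \<beta>) * (1 + n * \<beta>) - 1) / n"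
    using n by (simp add: field_simps)
  also have "\<dots> = - 1 / (n + 1)" unfolding \<beta> using n \<sigma> by (simp add: field_simps)
  finally have 1: "2 * \<beta> + n * (\<beta> * \<beta>) = - 1 / (n + 1)" .
  have 2: "- \<sigma> + n * (- \<sigma> * \<beta>) = - 1 / (n + 1)"
  proof -
    have "- \<sigma> + n * (- \<sigma> * \<beta>) = - \<sigma> * (1 + n * \<beta>)" by (simp add: algebra_simps)
    thus ?thesis unfolding \<beta> using \<sigma> by simp
  qed
  have 3: "n * (\<sigma> * \<sigma>) = 1 - 1 / (n + 1)" unfolding \<sigma> using n by (simp add: field_simps)
  have "w i \<bullet> w j = of_bool (i = j) - 1 / (n + 1)" for i j
    using 1 2 3
    by (cases i; cases j) (auto simp: w_def inner_add_left inner_add_right v inner_axis_axis mult_ac)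
  thus thesis unfolding n_def by (rule that)
qed

text \<open>The product of two normalised edge midpoints depends only on the number of shared
  vertices. The two products have sum (n-7)/(2(n-1)), so from n = 7 on this set belongs to the case
  a + b >= 0.\<close>

lemma exists_two_distance_set_of_pairs:
  assumes n: "3 \<le> CARD('n::finite)"
  shows "\<exists>S :: (real ^ 'n) set. finite S \<and> spherical_two_distance_set S \<and>
    card S = CARD('n) * (CARD('n) + 1) div 2"
proof -
  define n where "n = real CARD('n)"
  have n3: "n \<ge> 3" using assms by (simp add: n_def)
  obtain w :: "'n option \<Rightarrow> real ^ 'n"
    where w: "\<And>i j. w i \<bullet> w j = of_bool (i = j) - 1 / (n + 1)"
    using regular_simplex unfolding n_def by blast
  define Q :: "'n option set set" where "Q = {A. card A = 2}"
  \<comment> \<open>The length of w_i + w_j for distinct i, j: its square is 2 - 4/(n+1).\<close>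
  define R where "R = sqrt (2 * (n - 1) / (n + 1))"
  define z where "z A = (\<Sum>i\<in>A. w i) /\<^sub>R R" for A
  have R: "R > 0" "R * R = 2 * (n - 1) / (n + 1)" using n3 by (simp_all add: R_def)
  have ip: "z A \<bullet> z B = (real (card (A \<inter> B)) * (n + 1) - 4) / (2 * (n - 1))"
    if "A \<in> Q" "B \<in> Q" for A B
  proof -
    have "(\<Sum>i\<in>A. w i) \<bullet> (\<Sum>j\<in>B. w j) = (\<Sum>i\<in>A. \<Sum>j\<in>B. of_bool (i = j)) - (\<Sum>i\<in>A. \<Sum>j\<in>B. 1 / (n + 1))"
      by (simp only: inner_sum_left) (simp only: inner_sum_right w sum_subtractf)
    also have "(\<Sum>i\<in>A. \<Sum>j\<in>B. of_bool (i = j) :: real) = (\<Sum>i\<in>A. of_bool (i \<in> B))"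
      by (intro sum.cong refl) (simp add: of_bool_def)
    also have "\<dots> = real (card (A \<inter> B))" by (simp add: of_bool_def sum.If_cases Int_def)
    also have "(\<Sum>i\<in>A. \<Sum>j\<in>B. 1 / (n + 1)) = 4 / (n + 1)" using that by (simp add: Q_def)
    finally have "z A \<bullet> z B = (real (card (A \<inter> B)) - 4 / (n + 1)) / (R * R)"
      by (simp add: z_def divide_simps)
    also have "real (card (A \<inter> B)) - 4 / (n + 1) = (real (card (A \<inter> B)) * (n + 1) - 4) / (n + 1)"
      using n3 by (simp add: field_simps)
    finally show ?thesis unfolding R(2) using n3 by simp
  qed
  have unit: "z A \<bullet> z A = 1" if "A \<in> Q" for A
    using ip[OF that that] that n3 by (simp add: Q_def)
  \<comment> \<open>The factors 1 and 0 are the sizes of A \<inter> B, left unsimplified so that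
    \<open>ip\<close> applies literally.\<close>
  define a b where "a = (1 * (n + 1) - 4) / (2 * (n - 1))" "b = (0 * (n + 1) - 4) / (2 * (n - 1))"
  have "2 * (n - 1) > 0" using n3 by simp
  hence ab: "-1 \<le> a" "a < 1" "-1 \<le> b" "b < 1"
    using n3 unfolding a_b_def by (simp_all only: pos_le_divide_eq pos_divide_less_eq) auto
  have dist: "z A \<bullet> z B = a \<or> z A \<bullet> z B = b" if AB: "A \<in> Q" "B \<in> Q" "A \<noteq> B" for A B
  proof -
    have "card (A \<inter> B) < 2"
    proof (rule ccontr)
      assume "\<not> card (A \<inter> B) < 2"
      hence "A \<inter> B = A" "A \<inter> B = B"
        using AB(1,2) card_seteq[of A "A \<inter> B"] card_seteq[of B "A \<inter> B"] by (auto simp: Q_def)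
      thus False using AB(3) by simp
    qed
    hence "card (A \<inter> B) = 1 \<or> card (A \<inter> B) = 0" by linarith
    thus ?thesis using ip[OF AB(1,2)] by (auto simp: a_b_def)
  qed
  have "inj_on z Q"
  proof (rule inj_onI, rule ccontr)
    fix A B assume AB: "A \<in> Q" "B \<in> Q" "z A = z B" "A \<noteq> B"
    thus False using dist[of A B] unit[of B] ab by simp
  qed
  moreover have "card Q = CARD('n) * (CARD('n) + 1) div 2"
    using n_subsets[of "UNIV :: 'n option set" 2] by (simp add: Q_def card_UNIV_option choose_two mult.commute)
  ultimately have "card (z ` Q) = CARD('n) * (CARD('n) + 1) div 2" by (simp add: card_image)
  moreover have "spherical_two_distance_set (z ` Q)"
  proof -
    have "z ` Q \<subseteq> sphere 0 1" using unit by (auto simp: norm_eq_1)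
    moreover have "\<forall>x\<in>z ` Q. \<forall>y\<in>z ` Q. x \<noteq> y \<longrightarrow> x \<bullet> y = a \<or> x \<bullet> y = b"
      using dist by blast
    ultimately show ?thesis unfolding spherical_two_distance_set_def using ab by blast
  qed
  ultimately show ?thesis by (intro exI[of _ "z ` Q"]) simp
qed

section \<open>The case of negative sum\<close>

text \<open>With $A$ the adjacency matrix of the relation $\langle x, y\rangle = a$ and $k = (1-b)/(a-b)$, the
  matrix $A + kI = (G - bJ)/(a-b)$ has rank at most $n + 1$, where $G$ is the Gram matrix.\<close>

lemma inner_product_ratio_is_int:
  fixes S :: "(real ^ 'n) set"
  assumes fin: "finite S" and S: "S \<subseteq> sphere 0 1" and ab: "b < a" "a < 1"
    and ip: "\<And>x y. x \<in> S \<Longrightarrow> y \<in> S \<Longrightarrow> x \<noteq> y \<Longrightarrow> x \<bullet> y = a \<or> x \<bullet> y = b"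
    and card: "2 * (CARD('n) + 1) < card S"
  shows "(1 - b) / (a - b) \<in> \<int>"
proof -
  define M :: "real ^ 'n \<Rightarrow> real ^ 'n \<Rightarrow> int" where "M x y = of_bool (x \<noteq> y \<and> x \<bullet> y = a)" for x y
  \<comment> \<open>A factorisation of (G - bJ)/(a-b) through n + 1 slots: \<open>Some i\<close>
    carries the i-th coordinate for G, \<open>None\<close> the constant part -bJ.\<close>
  define B :: "real ^ 'n \<Rightarrow> 'n option \<Rightarrow> real" where
    "B x = case_option (- b / (a - b)) (\<lambda>i. x $ i / (a - b))" for x
  define Y :: "'n option \<Rightarrow> real ^ 'n \<Rightarrow> real" where "Y c y = case_option 1 (\<lambda>i. y $ i) c" for c y
  have "- ((1 - b) / (a - b)) \<in> \<int>"
  proof (rule eigenvalue_of_large_multiplicity_is_int[OF fin finite])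
    show "2 * CARD('n option) < card S" using card by (simp add: card_UNIV_option)
    fix x y assume xy: "x \<in> S" "y \<in> S"
    have "(\<Sum>c\<in>UNIV. B x c * Y c y) = (x \<bullet> y - b) / (a - b)"
      by (simp add: UNIV_option_conv sum.reindex B_def Y_def inner_vec_def sum_divide_distrib diff_divide_distrib)
    also have "\<dots> = real_of_int (M x y) - (if x = y then - ((1 - b) / (a - b)) else 0)"
    proof (cases "x = y")
      case True
      have "y \<bullet> y = 1" using S xy by (auto simp: dot_square_norm)
      thus ?thesis using True by (simp add: M_def)
    next
      case False
      thus ?thesis using ip[OF xy] ab by (auto simp: M_def)
    qed
    finally show "real_of_int (M x y) - (if x = y then - ((1 - b) / (a - b)) else 0) = (\<Sum>c\<in>UNIV. B x c * Y c y)"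
      by simp
  qed
  thus ?thesis by (metis Ints_minus minus_minus)
qed

text \<open>For $a + b < 0$ the set lifts to equiangular lines in dimension $n + 1$ with angle $\arccos(1/s)$,
  and this is their relative bound.\<close>

lemma relative_bound:
  fixes S :: "(real ^ 'n) set"
  assumes fin: "finite S" and nonempty: "S \<noteq> {}" and S: "S \<subseteq> sphere 0 1"
    and ab: "b < a" "a + b < 0"
    and ip: "\<And>x y. x \<in> S \<Longrightarrow> y \<in> S \<Longrightarrow> x \<noteq> y \<Longrightarrow> x \<bullet> y = a \<or> x \<bullet> y = b"
  defines "s \<equiv> 2 * ((1 - b) / (a - b)) - 1"
  shows "s\<^sup>2 * (real (card S) - CARD('n) - 1) \<le> (real CARD('n) + 1) * (real (card S) - 1)"
proof -
  \<comment> \<open>Centring at the midpoint c makes all off-diagonal entries of G - cJ equal to e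
    or -e, so their squares no longer distinguish a from b.\<close>
  define n N c e where "n = real CARD('n)" "N = real (card S)" "c = (a + b) / 2" "e = (a - b) / 2"
  note defs = this
  have n: "n > 0" and N: "N > 0" and e: "e > 0" and c: "c < 0"
    using fin nonempty ab by (auto simp: defs card_gt_0_iff)
  have sc: "s * e = 1 - c" using ab by (simp add: s_def defs field_simps)
  have rows: "(\<Sum>y\<in>S. (x \<bullet> y - c)\<^sup>2) = (1 - c)\<^sup>2 + (N - 1) * e\<^sup>2" if x: "x \<in> S" for x
  proof -
    have "(\<Sum>y\<in>S. (x \<bullet> y - c)\<^sup>2) = (x \<bullet> x - c)\<^sup>2 + (\<Sum>y\<in>S - {x}. (x \<bullet> y - c)\<^sup>2)"
      using fin x by (rule sum.remove)
    also have "x \<bullet> x = 1" using x S by (auto simp: dot_square_norm)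
    also have "(\<Sum>y\<in>S - {x}. (x \<bullet> y - c)\<^sup>2) = (\<Sum>y\<in>S - {x}. e\<^sup>2)"
    proof (rule sum.cong[OF refl])
      fix y assume "y \<in> S - {x}"
      hence "x \<bullet> y = a \<or> x \<bullet> y = b" using ip x by auto
      thus "(x \<bullet> y - c)\<^sup>2 = e\<^sup>2"
        by (auto simp: defs power2_eq_square field_simps)
    qed
    also have "\<dots> = (N - 1) * e\<^sup>2" using card.remove[OF fin x] by (simp add: defs)
    finally show ?thesis .
  qed
  \<comment> \<open>Here a + b < 0 enters: the linear kernel appears with weight -2c, and its
    positivity helps only because c is negative.\<close>
  have "N * (N * (1 / n + c\<^sup>2)) \<le> (\<Sum>x\<in>S. \<Sum>y\<in>S. (x \<bullet> y)\<^sup>2 - 1 / n) + (- 2 * c) * (\<Sum>x\<in>S. \<Sum>y\<in>S. x \<bullet> y)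
      + (\<Sum>x\<in>S. \<Sum>y\<in>S. 1 / n + c\<^sup>2)"
    using gegenbauer_positivity(1,2)[OF S order.refl] c
    by (simp add: defs mult_nonneg_nonneg del: sum_subtractf)
  also have "\<dots> = (\<Sum>x\<in>S. \<Sum>y\<in>S. (x \<bullet> y - c)\<^sup>2)"
    by (simp only: sum_distrib_left sum.distrib[symmetric]) (simp add: power2_eq_square algebra_simps)
  also have "\<dots> = N * ((1 - c)\<^sup>2 + (N - 1) * e\<^sup>2)" by (simp add: rows flip: defs(2))
  finally have *: "N * (1 / n + c\<^sup>2) \<le> (1 - c)\<^sup>2 + (N - 1) * e\<^sup>2"
    using N by simp
  \<comment> \<open>Cauchy-Schwarz for (sqrt n, 1) and (1/sqrt n, -c), with its defect written as a
    square. It eliminates c in favour of s and turns n into n + 1, the dimension of the lifted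
    lines.\<close>
  have "(n + 1) * (1 / n + c\<^sup>2) - (1 - c)\<^sup>2 = (1 + n * c)\<^sup>2 / n"
    using n by (simp add: field_simps power2_eq_square)
  also have "\<dots> \<ge> 0" using n by simp
  finally have "(1 - c)\<^sup>2 * N \<le> (n + 1) * (1 / n + c\<^sup>2) * N" using N by (intro mult_right_mono) auto
  also have "\<dots> \<le> (n + 1) * ((1 - c)\<^sup>2 + (N - 1) * e\<^sup>2)"
    using mult_left_mono[OF *, of "n + 1"] n by (simp add: mult_ac)
  finally have "e\<^sup>2 * (s\<^sup>2 * (N - n - 1)) \<le> e\<^sup>2 * ((n + 1) * (N - 1))"
    unfolding sc[symmetric] by (simp add: algebra_simps power_mult_distrib)
  hence "s\<^sup>2 * (N - n - 1) \<le> (n + 1) * (N - 1)" using e by simp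
  thus ?thesis by (simp add: defs)
qed

text \<open>With q = (2k-1)^2 the hypothesis is N(q-1-n) <= (q-1)(n+1). Inserting N > n(n+1)/2 and
  cancelling n + 1 leaves a quadratic condition on n alone; q > n + 1 keeps the factor of N
  positive.\<close>

lemma ratio_bound_arith:
  fixes n N q :: real
  assumes "q * (N - n - 1) \<le> (n + 1) * (N - 1)" "n * (n + 1) / 2 < N" "0 < n" "n + 1 < q"
  shows "n * (q - 1 - n) < 2 * (q - 1)"
proof -
  have "N * (q - 1 - n) \<le> (q - 1) * (n + 1)" using assms(1) by (simp add: algebra_simps)
  moreover have "n * (n + 1) / 2 * (q - 1 - n) < N * (q - 1 - n)"
    using assms by (intro mult_strict_right_mono) auto
  ultimately have "n * (n + 1) / 2 * (q - 1 - n) < (q - 1) * (n + 1)" by linarith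
  moreover have "(n + 1) * (n * (q - 1 - n)) = 2 * (n * (n + 1) / 2 * (q - 1 - n))"
    "(n + 1) * (2 * (q - 1)) = 2 * ((q - 1) * (n + 1))" by simp_all
  ultimately have "(n + 1) * (n * (q - 1 - n)) < (n + 1) * (2 * (q - 1))" by linarith
  thus ?thesis using assms(3) by simp
qed

lemma inner_product_ratio_cases:
  fixes S :: "(real ^ 'n) set"
  assumes fin: "finite S" and S: "S \<subseteq> sphere 0 1" and ab: "b < a" "a < 1" "a + b < 0"
    and ip: "\<And>x y. x \<in> S \<Longrightarrow> y \<in> S \<Longrightarrow> x \<noteq> y \<Longrightarrow> x \<bullet> y = a \<or> x \<bullet> y = b"
    and n: "7 \<le> CARD('n)" "CARD('n) \<le> 39" and card: "CARD('n) * (CARD('n) + 1) div 2 < card S"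
  shows "(1 - b) / (a - b) = 2 \<or> (1 - b) / (a - b) = 3 \<and> 22 \<le> CARD('n)"
proof -
  define n where "n = real CARD('n)"
  have n7: "7 \<le> n" "n \<le> 39" using n by (simp_all add: n_def)
  have "CARD('n) * (CARD('n) + 1) div 2 + 1 \<le> card S" using card by simp
  hence "real (CARD('n) * (CARD('n) + 1) div 2) + 1 \<le> real (card S)" by linarith
  moreover have "real (CARD('n) * (CARD('n) + 1) div 2) = n * (n + 1) / 2"
    using real_of_nat_div[of 2 "CARD('n) * (CARD('n) + 1)"] by (simp add: n_def algebra_simps)
  ultimately have N: "n * (n + 1) / 2 < card S" by linarith
  have "7 * (n + 1) \<le> n * (n + 1)" using n7 by (intro mult_right_mono) auto
  hence "real (2 * (CARD('n) + 1)) < real (card S)" using N n7 by (simp add: n_def)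
  hence "2 * (CARD('n) + 1) < card S" by (simp only: of_nat_less_iff)
  then obtain k where k: "(1 - b) / (a - b) = real_of_int k"
    using inner_product_ratio_is_int[OF fin S ab(1,2) ip] by (auto elim: Ints_cases)
  have "real_of_int k > 1" unfolding k[symmetric] using ab by (simp add: field_simps)
  hence k2: "k \<ge> 2" by linarith
  have "S \<noteq> {}" using card by auto
  hence rel: "(2 * real_of_int k - 1)\<^sup>2 * (card S - n - 1) \<le> (n + 1) * (real (card S) - 1)"
    using relative_bound[OF fin _ S ab(1,3) ip] by (simp add: k n_def)
  have N1: "0 \<le> card S - n - 1" using \<open>2 * (CARD('n) + 1) < card S\<close> by (simp add: n_def)
  have "k \<le> 3"
  proof (rule ccontr)
    assume "\<not> k \<le> 3"
    \<comment> \<open>k = 4 is the weakest case: larger k only increase q, so 49 may stand for all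
      of them.\<close>
    hence "7\<^sup>2 \<le> (2 * real_of_int k - 1)\<^sup>2" by (intro power_mono) auto
    hence "49 * (card S - n - 1) \<le> (2 * real_of_int k - 1)\<^sup>2 * (card S - n - 1)"
      using N1 by (intro mult_right_mono) auto
    hence "n * (49 - 1 - n) < 2 * (49 - 1)" using rel N n7 by (intro ratio_bound_arith) auto
    \<comment> \<open>Expanded, this gives n(48-n) >= 273 + 2n, well above 96.\<close>
    moreover have "0 \<le> (n - 7) * (39 - n)" using n7 by simp
    ultimately show False using n7 by (simp add: algebra_simps)
  qed
  moreover have "22 \<le> CARD('n)" if "k = 3"
  proof (rule ccontr)
    assume "\<not> 22 \<le> CARD('n)"
    hence "n \<le> 21" by (simp add: n_def)
    \<comment> \<open>For k = 3 the condition is n(24-n) < 48. It fails for 7 <= n <= 21 and holds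
      at n = 22, where 22 * 2 = 44; this is the source of the threshold.\<close>
    have "n * (25 - 1 - n) < 2 * (25 - 1)"
      using rel N n7 \<open>n \<le> 21\<close> that by (intro ratio_bound_arith) auto
    moreover have "0 \<le> (n - 7) * (21 - n)" using n7 \<open>n \<le> 21\<close> by simp
    ultimately show False using \<open>n \<le> 21\<close> by (simp add: algebra_simps)
  qed
  ultimately show ?thesis using k k2 by (cases "k = 2") auto
qed

section \<open>Assembling the upper bound and the theorem\<close>

lemma two_distance_card_le:
  fixes S :: "(real ^ 'n) set"
  assumes fin: "finite S" and S: "spherical_two_distance_set S"
    and n: "7 \<le> CARD('n)" "CARD('n) \<le> 39" "CARD('n) \<noteq> 22"
  shows "card S \<le> (if CARD('n) = 23 then 277 else CARD('n) * (CARD('n) + 1) div 2)"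
proof (rule ccontr)
  assume "\<not> ?thesis"
  hence large: "CARD('n) * (CARD('n) + 1) div 2 < card S" "CARD('n) = 23 \<Longrightarrow> 277 < card S"
    by (auto split: if_splits)
  have sph: "S \<subseteq> sphere 0 1" using S by (simp add: spherical_two_distance_set_def)
  obtain a b where ab: "b < a" "a < 1" "-1 \<le> b"
    and ip: "\<And>x y. x \<in> S \<Longrightarrow> y \<in> S \<Longrightarrow> x \<noteq> y \<Longrightarrow> x \<bullet> y = a \<or> x \<bullet> y = b"
  proof -
    obtain a b where *: "-1 \<le> a" "a < 1" "-1 \<le> b" "b < 1"
      "\<forall>x\<in>S. \<forall>y\<in>S. x \<noteq> y \<longrightarrow> x \<bullet> y = a \<or> x \<bullet> y = b"
      using S by (auto simp: spherical_two_distance_set_def)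
    consider "b < a" | "a < b" | "a = b" by linarith
    thus thesis
    proof cases
      case 1
      thus thesis using * by (intro that[of b a]) auto
    next
      case 2
      thus thesis using * by (intro that[of a b]) auto
    next
      case 3
      \<comment> \<open>With a single product b, any number strictly between b and 1 can serve as
        the larger value.\<close>
      thus thesis using * by (intro that[of b "(b + 1) / 2"]) auto
    qed
  qed
  have neg: "a + b < 0"
  proof (rule ccontr)
    assume "\<not> a + b < 0"
    hence "card S \<le> CARD('n) * (CARD('n) + 1) div 2"
      using two_distance_card_le_of_sum_nonneg[OF fin sph _ _ _ ip] ab by auto
    thus False using large by simp
  qed
  have mono: "p * (p + 1) div 2 \<le> CARD('n) * (CARD('n) + 1) div 2" if "p \<le> CARD('n)" for p
    using that by (intro div_le_mono mult_le_mono) auto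
  \<comment> \<open>Lets a whole block of dimensions be refuted by the target value of its lowest
    dimension p.\<close>
  have *: False if "p \<le> CARD('n)" "card S \<le> p * (p + 1) div 2" for p
    using mono[OF that(1)] that(2) large(1) by linarith
  show False
    using inner_product_ratio_cases[OF fin sph ab(1,2) neg ip n(1,2) large(1)]
  proof
    assume "(1 - b) / (a - b) = 2"
    hence b: "b = (2 * a - 1) / (2 - 1)" using ab by (simp add: field_simps)
    \<comment> \<open>The ends translate -1 <= b and a + b < 0 for b = 2a - 1; the interval
      [-1/3, 1/5] for k = 3 arises likewise from b = (3a-1)/2.\<close>
    have a: "0 \<le> a" "a \<le> 1 / 3" using b ab neg by auto
    note bd = lp_bound_2_dim_7[OF fin sph _ ip[unfolded b] a] lp_bound_2_dim_9[OF fin sph _ ip[unfolded b] a]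
      lp_bound_2_dim_12[OF fin sph _ ip[unfolded b] a] lp_bound_2_dim_17[OF fin sph _ ip[unfolded b] a]
      lp_bound_2_dim_28[OF fin sph _ ip[unfolded b] a] lp_bound_2_dim_35[OF fin sph _ ip[unfolded b] a]
      lp_bound_2_dim_38[OF fin sph _ ip[unfolded b] a] lp_bound_2_dim_39[OF fin sph _ ip[unfolded b] a]
    consider "CARD('n) \<le> 7" | "8 \<le> CARD('n)" "CARD('n) \<le> 9" | "10 \<le> CARD('n)" "CARD('n) \<le> 12"
      | "13 \<le> CARD('n)" "CARD('n) \<le> 17" | "18 \<le> CARD('n)" "CARD('n) \<le> 28"
      | "29 \<le> CARD('n)" "CARD('n) \<le> 35" | "36 \<le> CARD('n)" "CARD('n) \<le> 38" | "39 \<le> CARD('n)"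
      by linarith
    thus False
    proof cases
      case 1 thus False using bd(1) *[of 7] n by simp
    next
      case 2 thus False using bd(2) *[of 8] by simp
    next
      case 3 thus False using bd(3) *[of 10] by simp
    next
      case 4 thus False using bd(4) *[of 13] by simp
    next
      case 5 thus False using bd(5) *[of 18] by simp
    next
      case 6 thus False using bd(6) *[of 29] by simp
    next
      case 7 thus False using bd(7) *[of 36] by simp
    next
      case 8 thus False using bd(8) *[of 39] n by simp
    qed
  next
    assume k: "(1 - b) / (a - b) = 3 \<and> 22 \<le> CARD('n)"
    hence b: "b = (3 * a - 1) / (3 - 1)" using ab by (simp add: field_simps)
    have a: "- 1 / 3 \<le> a" "a \<le> 1 / 5" using b ab neg by (auto simp: field_simps)
    consider "CARD('n) = 23" | "24 \<le> CARD('n)" "CARD('n) \<le> 27" | "28 \<le> CARD('n)"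
      using k n(3) by linarith
    thus False
    proof cases
      case 1 thus False using lp_bound_3_dim_23[OF fin sph _ ip[unfolded b] a] large(2) by simp
    next
      case 2 thus False using lp_bound_3_dim_27[OF fin sph _ ip[unfolded b] a] *[of 24] by simp
    next
      case 3 thus False using lp_bound_3_dim_39[OF fin sph _ ip[unfolded b] a] *[of 28] n by simp
    qed
  qed
qed

theorem theorem4p3:
  fixes n :: nat
  assumes "n = CARD('n::finite)"
  shows "((6 < n \<and> n < 22) \<or> (23 < n \<and> n < 40) \<longrightarrow>
            max_two_distance TYPE('n) = n * (n + 1) div 2) \<and>
         (n = 23 \<longrightarrow>
            max_two_distance TYPE('n) = 276 \<or> max_two_distance TYPE('n) = 277)"
proof -
  define C where "C = {card S | S :: (real ^ 'n) set. finite S \<and> spherical_two_distance_set S}"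
  have max: "max_two_distance TYPE('n) = Max C" by (simp add: max_two_distance_def C_def)
  define u where "u = (if n = 23 then 277 else n * (n + 1) div 2)"
  have bounds: "n * (n + 1) div 2 \<le> Max C \<and> Max C \<le> u" if "7 \<le> n" "n \<le> 39" "n \<noteq> 22"
  proof -
    have le: "c \<le> u" if "c \<in> C" for c
      using that two_distance_card_le[where 'n = 'n] \<open>7 \<le> n\<close> \<open>n \<le> 39\<close> \<open>n \<noteq> 22\<close>
      unfolding C_def u_def assms by blast
    \<comment> \<open>The uniform upper bound is also what gives \<open>Max C\<close> its meaning,
      since it makes C finite.\<close>
    hence fin: "finite C" by (meson finite_nat_set_iff_bounded_le)
    moreover have low: "n * (n + 1) div 2 \<in> C"
    proof -
      have "3 \<le> CARD('n)" using \<open>7 \<le> n\<close> assms by simp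
      from exists_two_distance_set_of_pairs[OF this] show ?thesis
        unfolding C_def assms by (smt (verit) mem_Collect_eq)
    qed
    ultimately show ?thesis using le Max_in[of C] Max_ge[of C] by blast
  qed
  show ?thesis unfolding max using bounds by (cases "n = 23") (auto simp: u_def)
qed

end
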